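(* There exists an absolute constant $C>0$ such that for every $n\ge 2$ and every $j\in\{1,\dots,n\}$, \[ \sup_{\lambda>0}\lambda\,|\{x\in\mathbb{R}^n:|R_j\nu(x)|>\lambda\}|\le C\log(n)\,\|\nu\|_{M_b(\mathbb{R}^n)} \] for all measures $\nu$ of the form $\nu=\sum_{k=1}^N a_k\delta_{c_k}$ with $N\in\mathbb{N}$, $c_k\in\mathbb{R}^n$ and $a_k\in\mathbb{R}^+$.
   Context: For a finite Borel measure $\nu$ on $\mathbb{R}^n$ and $j\in\{1,\dots,n\}$, the $j$-th Riesz transform is $R_j\nu(x)=\frac{\Gamma(\frac{n+1}{2})}{\pi^{\frac{n+1}{2}}}\,\mathrm{p.v.}\int\frac{x_j-y_j}{|x-y|^{n+1}}\,d\nu(y)$; for $\nu=\sum_k a_k\delta_{c_k}$ this equals $\frac{\Gamma(\frac{n+1}{2})}{\pi^{\frac{n+1}{2}}}\sum_k a_k\frac{x_j-(c_k)_j}{|x-c_k|^{n+1}}$ for $x\notin\{c_k\}$. $\|\nu\|_{M_b(\mathbb{R}^n)}$ is the total variation of $\nu$ (here $\sum_k a_k$), and $|\cdot|$ is Lebesgue measure. *)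

theory Defs
  imports "HOL-Analysis.Analysis"
begin

definition lebesgue_n :: "nat \<Rightarrow> (nat \<Rightarrow> real) measure" where
  "lebesgue_n n = Pi\<^sub>M {..<n} (\<lambda>_. lborel)"

definition dist_n :: "nat \<Rightarrow> (nat \<Rightarrow> real) \<Rightarrow> (nat \<Rightarrow> real) \<Rightarrow> real" where
  "dist_n n x y = sqrt (\<Sum>i<n. (x i - y i)\<^sup>2)"

text \<open>Riesz transform (coordinate j, 0-based) of the measure sum_{k<N} a_k delta_{c_k},
  evaluated at a point x distinct from all c_k.\<close>
definition riesz_discrete ::
  "nat \<Rightarrow> nat \<Rightarrow> nat \<Rightarrow> (nat \<Rightarrow> real) \<Rightarrow> (nat \<Rightarrow> nat \<Rightarrow> real) \<Rightarrow> (nat \<Rightarrow> real) \<Rightarrow> real" where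
  "riesz_discrete n j N a c x =
     Gamma ((real n + 1) / 2) / pi powr ((real n + 1) / 2) *
     (\<Sum>k<N. a k * (x j - c k j) / (dist_n n x (c k)) ^ (n + 1))"

end

(* Fix a level l and put m_k = a_k / l. Greedily choose disjoint sets E_k inside balls B(c_k, r_k) with
   |E_k| = m_k whose union E is the union of these balls. Outside the balls dilated by 1 + 1/n, whose union has
   measure at most 3 |E|, the Riesz transform of nu - l 1_E is integrable with norm at most 15 ln n * |nu|: the
   logarithm is the integral of the kernel over the annulus r/n < |x - y| < 4 n r, with an absolute constant in
   front. The remaining term R_j 1_E is controlled in L^2 with an absolute constant.

   The L^2 bound uses no Fourier analysis. With the kernel regularized by replacing |z|^2 by |z|^2 + e^2, the
   squares of all Riesz transforms of 1_E and minus the square of its Poisson integral add up to a function of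
   integral zero. On kernels this says that
     (|x|^2 - T) / (|x - h|^2 + e^2)^((n+1)/2) (|x + h|^2 + e^2)^((n+1)/2),   T = |h|^2 + e^2,
   has integral zero, which follows in polar coordinates since the inversion rho -> T / (|x|^2 rho) of each
   ray reverses the sign. *)

theory Submission
  imports Defs "HOL-Real_Asymp.Real_Asymp"
begin

section \<open>Polar coordinates on a finite product of lines\<close>

text \<open>The obstacle is that the usual decompositions and covering lemmas cost factors
  exponential in n, and crude kernel bounds cost powers of n. Two facts keep the constants absolute:
  the normalising constant times the volume of the unit ball is at most 1 / sqrt n, and one
  coordinate has mean absolute value at most 1 / sqrt n over that ball. Together they cancel the
  dimension factor of polar integration. The radii in the logarithm have two sources. Dilation by 1
  + 1/n multiplies volume by less than e but leaves a gap of only r/n, while the power n + 1 in the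
  kernel makes its differences small only at distances of order n r. The quadratic identity comes
  from conjugate harmonic functions: at height e the Poisson and Riesz kernels form a generalised
  Cauchy-Riemann system. On a line it says that (P + iQ)^2 has integral zero, which is a contour
  integral. It needs the squares of all coordinates, although only one is wanted. Regularization
  replaces principal values by ordinary integrals; the final bounds do not depend on e, so e can
  tend to 0 at the end.\<close>

locale euclid_dim =
  fixes n :: nat
  assumes n2: "2 \<le> n"
begin

abbreviation M :: "(nat \<Rightarrow> real) measure" where
  "M \<equiv> Pi\<^sub>M {..<n} (\<lambda>_. lborel)"

section \<open>Euclidean norm, affine maps and their effect on the product measure\<close>

definition nrm :: "(nat \<Rightarrow> real) \<Rightarrow> real" where
  "nrm x = sqrt (\<Sum>i<n. (x i)\<^sup>2)"

text \<open>Points of the product space are \<open>undefined\<close> beyond the first n arguments,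
  hence the restriction. The kernels below instead receive plain differences such as
  \<open>\<lambda>i. x i - y i\<close>, which need not be points of \<open>M\<close>; congruence
  lemmas mediate between the two.\<close>

definition aff :: "real \<Rightarrow> (nat \<Rightarrow> real) \<Rightarrow> (nat \<Rightarrow> real) \<Rightarrow> nat \<Rightarrow> real" where
  "aff s b x = (\<lambda>i\<in>{..<n}. b i + s * x i)"

lemma n_pos [simp]: "0 < n" "n \<noteq> 0"
  using n2 by auto

sublocale P: product_sigma_finite "\<lambda>_::nat. lborel :: real measure"
  by standard

sublocale F: finite_product_sigma_finite "\<lambda>_::nat. lborel :: real measure" "{..<n}"
  by standard auto

sublocale MM: pair_sigma_finite M M
  by standard

sublocale MR: pair_sigma_finite M "lborel :: real measure"
  by standard

lemma nrm_L2_set: "nrm x = L2_set x {..<n}"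
  by (simp add: nrm_def L2_set_def)

lemma nrm_nonneg [simp]: "0 \<le> nrm x"
  by (simp add: nrm_L2_set)

lemma nrm_sq: "(nrm x)\<^sup>2 = (\<Sum>i<n. (x i)\<^sup>2)"
  by (simp add: nrm_def sum_nonneg)

lemma measurable_nrm [measurable (raw)]:
  assumes "\<And>i. i < n \<Longrightarrow> (\<lambda>w. f w i) \<in> borel_measurable N"
  shows "(\<lambda>w. nrm (f w)) \<in> borel_measurable N"
  using assms unfolding nrm_def by measurable

lemma nrm_cong: "(\<And>i. i < n \<Longrightarrow> x i = y i) \<Longrightarrow> nrm x = nrm y"
  by (simp add: nrm_def)

lemma aff_apply [simp]: "i < n \<Longrightarrow> aff s b x i = b i + s * x i"
  by (simp add: aff_def)

lemma aff_space [simp]: "aff s b x \<in> space M"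
  by (simp add: aff_def space_PiM)

lemma nrm_scale: "nrm (\<lambda>i. s * x i) = \<bar>s\<bar> * nrm x"
  by (simp add: nrm_def power_mult_distrib flip: sum_distrib_left add: real_sqrt_mult)

lemma nrm_aff0 [simp]: "nrm (aff s (\<lambda>_. 0) x) = \<bar>s\<bar> * nrm x"
  using nrm_scale[of s x] nrm_cong[of "aff s (\<lambda>_. 0) x" "\<lambda>i. s * x i"] by simp

lemma nrm_triangle: "nrm (\<lambda>i. x i + y i) \<le> nrm x + nrm y"
  unfolding nrm_L2_set by (rule L2_set_triangle_ineq)

lemma nrm_minus: "nrm (\<lambda>i. x i - y i) = nrm (\<lambda>i. y i - x i)"
  by (simp add: nrm_def power2_commute)

lemma nrm_uminus: "nrm (\<lambda>i. - x i) = nrm x"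
  by (simp add: nrm_def)

lemma nrm_diff_le: "nrm (\<lambda>i. x i - y i) \<le> nrm x + nrm y"
  using nrm_triangle[of x "\<lambda>i. - y i"] by (simp add: nrm_uminus)

lemma nrm_triangle_sub: "nrm x \<le> nrm y + nrm (\<lambda>i. x i - y i)"
  using nrm_triangle[of y "\<lambda>i. x i - y i"] by simp

lemma abs_coord_le_nrm: "i < n \<Longrightarrow> \<bar>x i\<bar> \<le> nrm x"
  using member_le_L2_set[of "{..<n}" i "\<lambda>i. \<bar>x i\<bar>"] by (simp add: L2_set_def nrm_def)

lemma measurable_aff [measurable (raw)]:
  assumes "s \<in> borel_measurable N" "\<And>i. i < n \<Longrightarrow> (\<lambda>w. b w i) \<in> borel_measurable N"
    "\<And>i. i < n \<Longrightarrow> (\<lambda>w. x w i) \<in> borel_measurable N"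
  shows "(\<lambda>w. aff (s w) (b w) (x w)) \<in> measurable N M"
  using assms unfolding aff_def by (intro measurable_restrict) auto

text \<open>The product measure is determined by its values on boxes, so the one-dimensional change
  of variables in each coordinate suffices; each coordinate contributes one factor |s|.\<close>

lemma lebesgue_affine:
  assumes "s \<noteq> 0"
  shows "M = density (distr M M (aff s b)) (\<lambda>_. ennreal (\<bar>s\<bar> ^ n))"
proof (rule P.PiM_eqI[symmetric])
  show "finite {..<n}" "sets (density (distr M M (aff s b)) (\<lambda>_. ennreal (\<bar>s\<bar> ^ n))) = sets M"
    by auto
  fix A :: "nat \<Rightarrow> real set"
  assume A: "\<And>i. i \<in> {..<n} \<Longrightarrow> A i \<in> sets lborel"
  have PA: "Pi\<^sub>E {..<n} A \<in> sets M"
    using A by (intro sets_PiM_I_finite) auto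
  have 1: "emeasure lborel (A i) = ennreal \<bar>s\<bar> * emeasure lborel ((\<lambda>t. b i + s * t) -` A i)" if "i < n" for i
    using A[of i] that
    by (subst lborel_real_affine[OF assms, of "b i"])
       (auto simp: emeasure_density emeasure_distr nn_integral_cmult nn_integral_distr)
  have 2: "aff s b -` Pi\<^sub>E {..<n} A \<inter> space M = Pi\<^sub>E {..<n} (\<lambda>i. (\<lambda>t. b i + s * t) -` A i)"
    by (auto simp: aff_def space_PiM PiE_iff)
  have 3: "(\<lambda>t. b i + s * t) -` A i \<in> sets lborel" if "i < n" for i
    using A[of i] that measurable_sets[of "\<lambda>t. b i + s * t" lborel borel "A i"] by auto
  have "emeasure (density (distr M M (aff s b)) (\<lambda>_. ennreal (\<bar>s\<bar> ^ n))) (Pi\<^sub>E {..<n} A) =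
      ennreal (\<bar>s\<bar> ^ n) * emeasure M (aff s b -` Pi\<^sub>E {..<n} A \<inter> space M)"
    using PA by (simp add: emeasure_density nn_integral_cmult emeasure_distr)
  also have "\<dots> = ennreal (\<bar>s\<bar> ^ n) * (\<Prod>i<n. emeasure lborel ((\<lambda>t. b i + s * t) -` A i))"
    unfolding 2 by (subst P.emeasure_PiM) (use 3 in auto)
  also have "\<dots> = (\<Prod>i<n. ennreal \<bar>s\<bar> * emeasure lborel ((\<lambda>t. b i + s * t) -` A i))"
    by (simp add: prod.distrib ennreal_power)
  also have "\<dots> = (\<Prod>i<n. emeasure lborel (A i))"
    using 1 by (intro prod.cong) auto
  finally show "emeasure (density (distr M M (aff s b)) (\<lambda>_. ennreal (\<bar>s\<bar> ^ n))) (Pi\<^sub>E {..<n} A) =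
      (\<Prod>i<n. emeasure lborel (A i))" .
qed

lemma nn_integral_aff:
  assumes [measurable]: "f \<in> borel_measurable M" and s: "s \<noteq> 0"
  shows "(\<integral>\<^sup>+x. f x \<partial>M) = ennreal (\<bar>s\<bar> ^ n) * (\<integral>\<^sup>+x. f (aff s b x) \<partial>M)"
proof -
  have "(\<integral>\<^sup>+x. f x \<partial>M) = (\<integral>\<^sup>+x. f x \<partial>density (distr M M (aff s b)) (\<lambda>_. ennreal (\<bar>s\<bar> ^ n)))"
    using lebesgue_affine[OF s] by simp
  also have "\<dots> = ennreal (\<bar>s\<bar> ^ n) * (\<integral>\<^sup>+x. f (aff s b x) \<partial>M)"
    by (simp add: nn_integral_density nn_integral_cmult nn_integral_distr)
  finally show ?thesis .
qed

lemma nn_integral_shift: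
  assumes "f \<in> borel_measurable M"
  shows "(\<integral>\<^sup>+x. f (aff 1 b x) \<partial>M) = (\<integral>\<^sup>+x. f x \<partial>M)"
  using nn_integral_aff[OF assms, of 1 b] by simp

lemma distr_shift: "distr M M (aff 1 b) = M"
proof -
  have "density N (\<lambda>_. 1) = N" for N :: "(nat \<Rightarrow> real) measure"
    by (rule density_1)
  then show ?thesis using lebesgue_affine[of 1 b] by simp
qed

lemma integral_shift:
  fixes f :: "_ \<Rightarrow> real"
  assumes [measurable]: "f \<in> borel_measurable M"
  shows "(\<integral>x. f (aff 1 b x) \<partial>M) = (\<integral>x. f x \<partial>M)"
  using integral_distr[of "aff 1 b" M M f] by (simp add: distr_shift)

lemma emeasure_aff:
  assumes [measurable]: "A \<in> sets M" and s: "s \<noteq> 0"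
  shows "emeasure M A = ennreal (\<bar>s\<bar> ^ n) * emeasure M {x \<in> space M. aff s b x \<in> A}"
proof -
  have "emeasure M A = (\<integral>\<^sup>+x. indicator A x \<partial>M)"
    by simp
  also have "\<dots> = ennreal (\<bar>s\<bar> ^ n) * (\<integral>\<^sup>+x. indicator A (aff s b x) \<partial>M)"
    by (rule nn_integral_aff) (use s in auto)
  also have "(\<integral>\<^sup>+x. indicator A (aff s b x) \<partial>M) = (\<integral>\<^sup>+x. indicator {x \<in> space M. aff s b x \<in> A} x \<partial>M)"
    by (intro nn_integral_cong) (auto simp: indicator_def)
  finally show ?thesis by simp
qed

section \<open>Volume of balls\<close>

definition ball_vol :: real where
  "ball_vol = unit_ball_vol (real n)"

lemma ball_vol_pos [simp]: "0 < ball_vol"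
  by (simp add: ball_vol_def)

definition cball_n :: "(nat \<Rightarrow> real) \<Rightarrow> real \<Rightarrow> (nat \<Rightarrow> real) set" where
  "cball_n c r = {x \<in> space M. nrm (\<lambda>i. x i - c i) \<le> r}"

lemma sets_cball_n [measurable]: "cball_n c r \<in> sets M"
  unfolding cball_n_def by measurable

lemma emeasure_cball_n:
  assumes "0 \<le> r"
  shows "emeasure M (cball_n c r) = ennreal (ball_vol * r ^ n)"
proof -
  have pos: "emeasure M (cball_n c r) = ennreal (ball_vol * r ^ n)" if "0 < r" for r
  proof -
    have "emeasure M (cball_n c r) = emeasure M {x \<in> space M. aff 1 c x \<in> cball_n c r}"
      using emeasure_aff[of "cball_n c r" 1 c] by simp
    also have "{x \<in> space M. aff 1 c x \<in> cball_n c r} = {x. sqrt (\<Sum>i<n. (x i)\<^sup>2) \<le> r} \<inter> space M"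
      by (auto simp: cball_n_def nrm_def)
    also have "emeasure M \<dots> = ennreal (ball_vol * r ^ n)"
      using emeasure_cball_aux[of "{..<n}" r] that by (simp add: ball_vol_def)
    finally show ?thesis .
  qed
  show ?thesis
  proof (cases "r = 0")
    case True
    \<comment> \<open>Radius zero lies below every positive radius, so its volume is squeezed by the
      limit of the positive case. This is what makes the centre a null set.\<close>
    have lim: "((\<lambda>r. ennreal (ball_vol * r ^ n)) \<longlongrightarrow> ennreal (ball_vol * 0 ^ n)) (at_right 0)"
      by (intro tendsto_intros)
    have "emeasure M (cball_n c 0) \<le> ennreal (ball_vol * 0 ^ n)"
    proof (rule tendsto_lowerbound[OF lim])
      show "\<forall>\<^sub>F r in at_right 0. emeasure M (cball_n c 0) \<le> ennreal (ball_vol * r ^ n)"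
      proof (rule eventually_at_right_less[THEN eventually_mono])
        fix r :: real assume "0 < r"
        then have "emeasure M (cball_n c 0) \<le> emeasure M (cball_n c r)"
          by (intro emeasure_mono) (auto simp: cball_n_def)
        with pos[OF \<open>0 < r\<close>] show "emeasure M (cball_n c 0) \<le> ennreal (ball_vol * r ^ n)" by simp
      qed
    qed simp
    with True show ?thesis by (simp add: zero_power)
  qed (use assms pos in auto)
qed

lemma AE_nrm_neq_0: "AE x in M. nrm x \<noteq> 0"
proof (rule AE_I)
  show "{x \<in> space M. \<not> nrm x \<noteq> 0} \<subseteq> cball_n (\<lambda>_. 0) 0"
    by (auto simp: cball_n_def)
qed (auto simp: emeasure_cball_n zero_power)

section \<open>Integration along rays without a surface measure\<close>

lemma nn_integral_power_tail:
  fixes a :: real and p :: nat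
  assumes "0 < a" "0 < p"
  shows "(\<integral>\<^sup>+\<rho>. ennreal (p / \<rho> ^ (p + 1)) * indicator {a..} \<rho> \<partial>lborel) = ennreal (1 / a ^ p)"
proof -
  have "(\<integral>\<^sup>+\<rho>. ennreal (p / \<rho> ^ (p + 1)) * indicator {a..} \<rho> \<partial>lborel) = ennreal (0 - (- (1 / a ^ p)))"
  proof (rule nn_integral_FTC_atLeast)
    fix x assume "a \<le> x"
    with assms have x: "0 < x" by simp
    show "((\<lambda>x. - (1 / x ^ p)) has_real_derivative p / x ^ (p + 1)) (at x)"
      using x assms
      by (auto intro!: derivative_eq_intros simp: field_simps simp flip: power_Suc power_add)
    show "0 \<le> p / x ^ (p + 1)" using x by simp
  next
    show "((\<lambda>x::real. - (1 / x ^ p)) \<longlongrightarrow> 0) at_top"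
      using assms by real_asymp
  qed measurable
  then show ?thesis by simp
qed

text \<open>The unit ball with weight \<open>p * nrm x ^ p\<close> plays the role of the sphere. For
  a fixed scale, y = rho x turns the right side into an integral over |y| <= rho with density p
  |y|^p / rho^(p + 1), and integrating this density over rho >= |y| gives 1. The exponent p is free
  and is adapted to each integrand.\<close>

lemma nn_integral_polar:
  fixes p :: nat
  assumes [measurable]: "f \<in> borel_measurable M" and p: "0 < p"
  shows "(\<integral>\<^sup>+x. f x \<partial>M) =
    (\<integral>\<^sup>+x. \<integral>\<^sup>+\<rho>. ennreal (indicator {..1} (nrm x) * real p * nrm x ^ p * (indicator {0<..} \<rho> * \<rho> ^ (n - 1)))
        * f (aff \<rho> (\<lambda>_. 0) x) \<partial>lborel \<partial>M)"
proof -
  define W where "W = (\<lambda>x \<rho>. ennreal (indicator {..1} (nrm x) * real p * nrm x ^ p * (indicator {0<..} \<rho> * \<rho> ^ (n - 1)))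
        * f (aff \<rho> (\<lambda>_. 0) x))"
  define G where "G = (\<lambda>(y, \<rho>). ennreal (indicator {0<..} \<rho> * indicator {..\<rho>} (nrm y) * real p * nrm y ^ p / \<rho> ^ (p + 1)) * f y)"
  have ind_eq: "indicator {..\<rho>} (nrm y) = (if nrm y \<le> \<rho> then 1 else 0 :: real)" for y \<rho>
    by auto
  have W_meas: "case_prod W \<in> borel_measurable (M \<Otimes>\<^sub>M lborel)"
    unfolding W_def ind_eq by measurable
  have G_meas [measurable]: "G \<in> borel_measurable (M \<Otimes>\<^sub>M lborel)"
    unfolding G_def ind_eq by measurable
  have inner: "(\<integral>\<^sup>+x. W x \<rho> \<partial>M) = (\<integral>\<^sup>+y. G (y, \<rho>) \<partial>M)" for \<rho>
  proof (cases "0 < \<rho>")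
    case True
    have "(\<integral>\<^sup>+y. G (y, \<rho>) \<partial>M) = ennreal (\<bar>\<rho>\<bar> ^ n) * (\<integral>\<^sup>+x. G (aff \<rho> (\<lambda>_. 0) x, \<rho>) \<partial>M)"
      by (rule nn_integral_aff) (use True in auto)
    also have "\<dots> = (\<integral>\<^sup>+x. ennreal (\<bar>\<rho>\<bar> ^ n) * G (aff \<rho> (\<lambda>_. 0) x, \<rho>) \<partial>M)"
      by (rule nn_integral_cmult[symmetric]) measurable
    also have "\<dots> = (\<integral>\<^sup>+x. W x \<rho> \<partial>M)"
    proof (rule nn_integral_cong)
      fix x
      have pw: "\<rho> ^ n = \<rho> * \<rho> ^ (n - 1)"
        by (simp flip: power_Suc)
      have 1: "\<rho> ^ n * (p * (\<rho> * nrm x) ^ p / \<rho> ^ (p + 1)) = p * nrm x ^ p * \<rho> ^ (n - 1)"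
        using True by (simp add: pw power_mult_distrib)
      have 2: "\<rho> * nrm x \<le> \<rho> \<longleftrightarrow> nrm x \<le> 1"
        using True by (simp add: mult_le_cancel_left1)
      show "ennreal (\<bar>\<rho>\<bar> ^ n) * G (aff \<rho> (\<lambda>_. 0) x, \<rho>) = W x \<rho>"
      proof (cases "nrm x \<le> 1")
        case le: True
        have "ennreal (\<bar>\<rho>\<bar> ^ n) * G (aff \<rho> (\<lambda>_. 0) x, \<rho>) =
            ennreal (\<rho> ^ n) * ennreal (p * (\<rho> * nrm x) ^ p / \<rho> ^ (p + 1)) * f (aff \<rho> (\<lambda>_. 0) x)"
          using True 2 le by (simp add: G_def mult.assoc)
        also have "\<dots> = ennreal (p * nrm x ^ p * \<rho> ^ (n - 1)) * f (aff \<rho> (\<lambda>_. 0) x)"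
          using True unfolding 1[symmetric] by (subst ennreal_mult) auto
        also have "\<dots> = W x \<rho>" using True le by (simp add: W_def)
        finally show ?thesis .
      qed (use True 2 in \<open>auto simp: G_def W_def\<close>)
    qed
    finally show ?thesis by simp
  qed (auto simp: W_def G_def)
  have radial: "(\<integral>\<^sup>+\<rho>. G (y, \<rho>) \<partial>lborel) = f y" if "nrm y \<noteq> 0" for y
  proof -
    have pos: "0 < nrm y" using that nrm_nonneg[of y] by linarith
    have "(\<integral>\<^sup>+\<rho>. G (y, \<rho>) \<partial>lborel) =
        (\<integral>\<^sup>+\<rho>. (f y * ennreal (nrm y ^ p)) * (ennreal (p / \<rho> ^ (p + 1)) * indicator {nrm y..} \<rho>) \<partial>lborel)"
    proof (rule nn_integral_cong)
      fix \<rho>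
      have "ennreal (p * nrm y ^ p / \<rho> ^ (p + 1)) = ennreal (nrm y ^ p) * ennreal (p / \<rho> ^ (p + 1))" if "0 < \<rho>"
        using that by (subst ennreal_mult[symmetric]) (auto simp: mult_ac)
      then show "G (y, \<rho>) = (f y * ennreal (nrm y ^ p)) * (ennreal (p / \<rho> ^ (p + 1)) * indicator {nrm y..} \<rho>)"
        using pos unfolding G_def by (cases "0 < \<rho> \<and> nrm y \<le> \<rho>") (auto simp: mult_ac)
    qed
    also have "\<dots> = f y * ennreal (nrm y ^ p) * ennreal (1 / nrm y ^ p)"
      by (subst nn_integral_cmult) (use nn_integral_power_tail[OF pos p] in auto)
    also have "\<dots> = f y"
      using pos by (simp add: mult.assoc flip: ennreal_mult')
    finally show ?thesis .
  qed
  have "(\<integral>\<^sup>+x. \<integral>\<^sup>+\<rho>. W x \<rho> \<partial>lborel \<partial>M) = (\<integral>\<^sup>+\<rho>. \<integral>\<^sup>+x. W x \<rho> \<partial>M \<partial>lborel)"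
    using MR.Fubini'[OF W_meas] by simp
  also have "\<dots> = (\<integral>\<^sup>+\<rho>. \<integral>\<^sup>+y. G (y, \<rho>) \<partial>M \<partial>lborel)"
    by (simp add: inner)
  also have "\<dots> = (\<integral>\<^sup>+y. \<integral>\<^sup>+\<rho>. G (y, \<rho>) \<partial>lborel \<partial>M)"
    by (rule MR.Fubini) measurable
  also have "\<dots> = (\<integral>\<^sup>+y. f y \<partial>M)"
    using AE_nrm_neq_0 by (intro nn_integral_cong_AE) (auto simp: radial elim!: eventually_mono AE_mp)
  finally show ?thesis by (simp add: W_def)
qed

text \<open>With p = n + d the power of |x| in the polar weight is exactly what the substitution rho
  -> |x| rho absorbs, so the radial factor has the same ray integral for every x and splits
  off.\<close>

lemma nn_integral_homogeneous_radial:
  fixes u :: "(nat \<Rightarrow> real) \<Rightarrow> real" and F :: "real \<Rightarrow> real"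
  assumes [measurable]: "u \<in> borel_measurable M" "F \<in> borel_measurable borel"
    and u_nonneg: "\<And>x. 0 \<le> u x" and F_nonneg: "\<And>\<rho>. 0 \<le> F \<rho>"
    and hom: "\<And>x \<rho>. 0 < \<rho> \<Longrightarrow> u (aff \<rho> (\<lambda>_. 0) x) = \<rho> ^ d * u x"
  shows "(\<integral>\<^sup>+x. ennreal (u x * F (nrm x)) \<partial>M) =
    ennreal (n + d) * (\<integral>\<^sup>+x. ennreal (u x) * indicator {x. nrm x \<le> 1} x \<partial>M) *
      (\<integral>\<^sup>+\<rho>. ennreal (\<rho> ^ (n + d - 1) * F \<rho>) * indicator {0<..} \<rho> \<partial>lborel)"
proof -
  let ?J = "\<integral>\<^sup>+\<rho>. ennreal (\<rho> ^ (n + d - 1) * F \<rho>) * indicator {0<..} \<rho> \<partial>lborel"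
  have "(\<integral>\<^sup>+x. ennreal (u x * F (nrm x)) \<partial>M) =
    (\<integral>\<^sup>+x. \<integral>\<^sup>+\<rho>. ennreal (indicator {..1} (nrm x) * real (n + d) * nrm x ^ (n + d) * (indicator {0<..} \<rho> * \<rho> ^ (n - 1)))
        * ennreal (u (aff \<rho> (\<lambda>_. 0) x) * F (nrm (aff \<rho> (\<lambda>_. 0) x))) \<partial>lborel \<partial>M)"
    using nn_integral_polar[of "\<lambda>x. ennreal (u x * F (nrm x))" "n + d"] by simp
  also have "\<dots> = (\<integral>\<^sup>+x. ennreal (n + d) * (ennreal (u x) * indicator {x. nrm x \<le> 1} x) * ?J \<partial>M)"
  proof (rule nn_integral_cong_AE, use AE_nrm_neq_0 in eventually_elim)
    fix x assume "nrm x \<noteq> 0"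
    then have pos: "0 < nrm x" using nrm_nonneg[of x] by linarith
    have "(\<integral>\<^sup>+\<rho>. ennreal (indicator {..1} (nrm x) * real (n + d) * nrm x ^ (n + d) * (indicator {0<..} \<rho> * \<rho> ^ (n - 1)))
        * ennreal (u (aff \<rho> (\<lambda>_. 0) x) * F (nrm (aff \<rho> (\<lambda>_. 0) x))) \<partial>lborel) =
      (\<integral>\<^sup>+\<rho>. (ennreal (n + d) * (ennreal (u x) * indicator {x. nrm x \<le> 1} x)) * (ennreal \<bar>nrm x\<bar> *
         (ennreal ((0 + nrm x * \<rho>) ^ (n + d - 1) * F (0 + nrm x * \<rho>)) * indicator {0<..} (0 + nrm x * \<rho>))) \<partial>lborel)"
    proof (rule nn_integral_cong)
      fix \<rho> :: real
      have e: "n + d - 1 = n - 1 + d" "n + d = Suc (n + d - 1)"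
        using n_pos(1) by linarith+
      have pw: "nrm x ^ (n + d) = nrm x * nrm x ^ (n + d - 1)" "\<rho> ^ (n + d - 1) = \<rho> ^ (n - 1) * \<rho> ^ d"
        using e by (metis power_Suc, metis power_add)
      show "ennreal (indicator {..1} (nrm x) * real (n + d) * nrm x ^ (n + d) * (indicator {0<..} \<rho> * \<rho> ^ (n - 1)))
        * ennreal (u (aff \<rho> (\<lambda>_. 0) x) * F (nrm (aff \<rho> (\<lambda>_. 0) x))) =
        (ennreal (n + d) * (ennreal (u x) * indicator {x. nrm x \<le> 1} x)) * (ennreal \<bar>nrm x\<bar> *
         (ennreal ((0 + nrm x * \<rho>) ^ (n + d - 1) * F (0 + nrm x * \<rho>)) * indicator {0<..} (0 + nrm x * \<rho>)))"
      proof (cases "0 < \<rho> \<and> nrm x \<le> 1")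
        case True
        have "real (n + d) * nrm x ^ (n + d) * \<rho> ^ (n - 1) * (\<rho> ^ d * u x * F (\<rho> * nrm x)) =
            real (n + d) * u x * (nrm x * ((nrm x * \<rho>) ^ (n + d - 1) * F (nrm x * \<rho>)))"
          unfolding pw power_mult_distrib by (simp add: mult_ac)
        from arg_cong[OF this, of ennreal] True pos u_nonneg F_nonneg show ?thesis
          by (simp add: hom ennreal_mult mult_ac del: ennreal_plus)
      qed (use pos in \<open>auto simp: zero_less_mult_iff\<close>)
    qed
    also have "\<dots> = ennreal (n + d) * (ennreal (u x) * indicator {x. nrm x \<le> 1} x) * ?J"
      using pos nn_integral_real_affine[of "\<lambda>\<rho>. ennreal (\<rho> ^ (n + d - 1) * F \<rho>) * indicator {0<..} \<rho>" "nrm x" 0]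
      by (simp add: nn_integral_cmult)
    finally show "(\<integral>\<^sup>+\<rho>. ennreal (indicator {..1} (nrm x) * real (n + d) * nrm x ^ (n + d) * (indicator {0<..} \<rho> * \<rho> ^ (n - 1)))
        * ennreal (u (aff \<rho> (\<lambda>_. 0) x) * F (nrm (aff \<rho> (\<lambda>_. 0) x))) \<partial>lborel) =
      ennreal (n + d) * (ennreal (u x) * indicator {x. nrm x \<le> 1} x) * ?J" .
  qed
  also have "\<dots> = ennreal (n + d) * (\<integral>\<^sup>+x. ennreal (u x) * indicator {x. nrm x \<le> 1} x \<partial>M) * ?J"
    by (simp add: nn_integral_cmult nn_integral_multc)
  finally show ?thesis .
qed

end

text \<open>Log-convexity of Gamma at the midpoint of x and x + 1, followed by the functional
  equation.\<close>

lemma Gamma_half_ratio: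
  fixes x :: real
  assumes "0 < x"
  shows "(Gamma (x + 1 / 2))\<^sup>2 \<le> (Gamma (x + 1))\<^sup>2 / x"
proof -
  have "(ln \<circ> Gamma) ((1 - 1/2) *\<^sub>R x + (1/2) *\<^sub>R (x + 1)) \<le> (1 - 1/2) * (ln \<circ> Gamma) x + (1/2) * (ln \<circ> Gamma) (x + 1)"
    using assms by (intro convex_onD[OF log_convex_Gamma_real]) auto
  also have "(1 - 1/2) *\<^sub>R x + (1/2) *\<^sub>R (x + 1) = x + 1 / 2" by (simp add: field_simps)
  finally have "2 * ln (Gamma (x + 1 / 2)) \<le> ln (Gamma x) + ln (Gamma (x + 1))"
    by simp
  moreover have pos: "0 < Gamma x" "0 < Gamma (x + 1)" "0 < Gamma (x + 1 / 2)"
    using assms by (auto intro!: Gamma_real_pos)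
  ultimately have "ln ((Gamma (x + 1 / 2))\<^sup>2) \<le> ln (Gamma x * Gamma (x + 1))"
    by (simp add: ln_mult_pos ln_realpow)
  then have "(Gamma (x + 1 / 2))\<^sup>2 \<le> Gamma x * Gamma (x + 1)"
    using pos by simp
  also have "\<dots> = (Gamma (x + 1))\<^sup>2 / x"
  proof -
    have "x \<notin> \<int>\<^sub>\<le>\<^sub>0" using assms by (auto dest: nonpos_Ints_nonpos)
    from Gamma_plus1[OF this] have "Gamma x = Gamma (x + 1) / x" using assms by simp
    then show ?thesis by (simp add: power2_eq_square)
  qed
  finally show ?thesis .
qed

lemma nn_integral_inverse_square_plus:
  fixes a :: real
  assumes "0 < a"
  shows "(\<integral>\<^sup>+\<rho>. ennreal (1 / (\<rho>\<^sup>2 + a\<^sup>2)) * indicator {0<..} \<rho> \<partial>lborel) = ennreal (pi / (2 * a))"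
proof -
  have "(\<integral>\<^sup>+\<rho>. ennreal (1 / (\<rho>\<^sup>2 + a\<^sup>2)) * indicator {0<..} \<rho> \<partial>lborel) =
      (\<integral>\<^sup>+\<rho>. ennreal (1 / (\<rho>\<^sup>2 + a\<^sup>2)) * indicator {0..} \<rho> \<partial>lborel)"
    by (intro nn_integral_cong_AE AE_I[of _ _ "{0}"]) (auto simp: indicator_def)
  also have "\<dots> = ennreal (pi / 2 / a - arctan (0 / a) / a)"
  proof (rule nn_integral_FTC_atLeast)
    fix x :: real
    have "1 / a * (1 / (1 + (x / a)\<^sup>2)) / a = 1 / (a\<^sup>2 * (1 + (x / a)\<^sup>2))"
      by (simp add: power2_eq_square)
    also have "a\<^sup>2 * (1 + (x / a)\<^sup>2) = x\<^sup>2 + a\<^sup>2"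
      using assms by (simp add: power_divide algebra_simps)
    finally show "((\<lambda>x. arctan (x / a) / a) has_real_derivative 1 / (x\<^sup>2 + a\<^sup>2)) (at x)"
      using assms by (auto intro!: derivative_eq_intros simp: inverse_eq_divide mult_ac)
    have "filterlim (\<lambda>x. x / a) at_top at_top"
      using assms by real_asymp
    then show "((\<lambda>x. arctan (x / a) / a) \<longlongrightarrow> pi / 2 / a) at_top"
      by (intro tendsto_divide filterlim_compose[OF tendsto_arctan_at_top]) (use assms in auto)
  qed (auto simp: add_nonneg_nonneg)
  finally show ?thesis by (simp add: mult.commute)
qed

context euclid_dim
begin

text \<open>The factor n / 4 in front of e^2 is the point: the Poisson kernel lives at radius about
  sqrt n * e. Without this factor its mass would be bounded only by a multiple of sqrt n.\<close>

lemma power_ratio_le: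
  fixes \<rho> e :: real
  assumes "0 < \<rho>" "0 < e"
  shows "\<rho> ^ (n - 1) / sqrt (\<rho>\<^sup>2 + e\<^sup>2) ^ (n + 1) \<le> 1 / (\<rho>\<^sup>2 + (sqrt n / 2 * e)\<^sup>2)"
proof -
  define s where "s = sqrt (\<rho>\<^sup>2 + e\<^sup>2)"
  have s: "s\<^sup>2 = \<rho>\<^sup>2 + e\<^sup>2" "0 < s" "\<rho> \<le> s"
    using assms by (auto simp: s_def add_pos_pos intro: real_le_rsqrt)
  \<comment> \<open>Bernoulli's inequality for (1 + q)^h with q = e^2 / rho^2 supplies a factor h >=
    n / 4. The parity of n - 1 leaves at most one further factor rho, bounded by s. At n = 2 the
    exponent h is zero, so that case is treated directly.\<close>
  define h where "h = (n - 1) div 2"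
  have key: "\<rho> ^ (n - 1) * (\<rho>\<^sup>2 + n / 4 * e\<^sup>2) \<le> s ^ (n + 1)"
  proof (cases "n = 2")
    case True
    have "\<rho> * (\<rho>\<^sup>2 + n / 4 * e\<^sup>2) \<le> s * s\<^sup>2"
      using True s assms by (intro mult_mono) auto
    with True show ?thesis by (simp add: power2_eq_square eval_nat_numeral)
  next
    case False
    then have h: "n - 1 = (n - 1 - 2 * h) + 2 * h" "real n / 4 \<le> real h" "n + 1 = (n - 1 - 2 * h) + 2 * h + 2"
    proof -
      have 2: "2 * h \<le> n - 1" by (simp add: h_def)
      with n2 show "n - 1 = (n - 1 - 2 * h) + 2 * h" "n + 1 = (n - 1 - 2 * h) + 2 * h + 2" by linarith+
      have "n \<le> 4 * h" using n2 False unfolding h_def by presburger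
      then show "real n / 4 \<le> real h" by linarith
    qed
    define q where "q = e\<^sup>2 / \<rho>\<^sup>2"
    have q: "0 \<le> q" "\<rho>\<^sup>2 * q = e\<^sup>2" using assms by (auto simp: q_def)
    have B: "1 + h * q \<le> (1 + q) ^ h"
      using q(1) by (intro Bernoulli_inequality) simp
    have "\<rho> ^ (2 * h) * (\<rho>\<^sup>2 + n / 4 * e\<^sup>2) = \<rho>\<^sup>2 * ((\<rho>\<^sup>2) ^ h * (1 + n / 4 * q))"
      unfolding q(2)[symmetric] power_mult by (simp only: algebra_simps)
    also have "\<dots> \<le> \<rho>\<^sup>2 * ((\<rho>\<^sup>2) ^ h * (1 + q) ^ h)"
      using mult_right_mono[OF h(2) q(1)] B by (intro mult_left_mono) auto
    also have "\<dots> = \<rho>\<^sup>2 * (s\<^sup>2) ^ h"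
      unfolding s(1) q(2)[symmetric] power_mult_distrib[symmetric] by (simp add: algebra_simps)
    also have "\<dots> \<le> s\<^sup>2 * (s\<^sup>2) ^ h"
      using s assms by (intro mult_right_mono power_mono) auto
    finally have 1: "\<rho> ^ (2 * h) * (\<rho>\<^sup>2 + n / 4 * e\<^sup>2) \<le> s\<^sup>2 * (s\<^sup>2) ^ h" .
    have "\<rho> ^ (n - 1) * (\<rho>\<^sup>2 + n / 4 * e\<^sup>2) = \<rho> ^ (n - 1 - 2 * h) * (\<rho> ^ (2 * h) * (\<rho>\<^sup>2 + n / 4 * e\<^sup>2))"
      by (subst h(1)) (simp add: power_add del: h(1))
    also have "\<dots> \<le> s ^ (n - 1 - 2 * h) * (s\<^sup>2 * (s\<^sup>2) ^ h)"
      by (intro mult_mono[OF power_mono 1]) (use s assms in auto)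
    also have "\<dots> = s ^ (n + 1)"
      unfolding power_mult[symmetric] power_add[symmetric] using h(3) by (intro arg_cong[of _ _ "(^) s"]) linarith
    finally show ?thesis .
  qed
  have "\<rho>\<^sup>2 + (sqrt n / 2 * e)\<^sup>2 = \<rho>\<^sup>2 + n / 4 * e\<^sup>2"
    by (simp add: power_mult_distrib power_divide)
  moreover have "0 < \<rho>\<^sup>2 + n / 4 * e\<^sup>2"
    using assms by (intro add_pos_nonneg) auto
  ultimately show ?thesis
    using key s(2) unfolding s_def[symmetric] by (simp add: divide_simps mult_ac)
qed

lemma nn_integral_radial:
  assumes [measurable]: "F \<in> borel_measurable borel" and F: "\<And>\<rho>. 0 \<le> F \<rho>"
  shows "(\<integral>\<^sup>+x. ennreal (F (nrm x)) \<partial>M) =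
    ennreal (n * ball_vol) * (\<integral>\<^sup>+\<rho>. ennreal (\<rho> ^ (n - 1) * F \<rho>) * indicator {0<..} \<rho> \<partial>lborel)"
proof -
  have "(\<integral>\<^sup>+x. ennreal 1 * indicator {x. nrm x \<le> 1} x \<partial>M) = (\<integral>\<^sup>+x. indicator (cball_n (\<lambda>_. 0) 1) x \<partial>M)"
    by (intro nn_integral_cong) (auto simp: cball_n_def indicator_def)
  also have "\<dots> = ennreal ball_vol"
    by (simp add: emeasure_cball_n)
  finally have 1: "(\<integral>\<^sup>+x. ennreal 1 * indicator {x. nrm x \<le> 1} x \<partial>M) = ennreal ball_vol" .
  show ?thesis
    using nn_integral_homogeneous_radial[of "\<lambda>_. 1" F 0] F
    unfolding 1 by (simp add: ennreal_mult less_imp_le)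
qed

section \<open>Moments of one coordinate\<close>

lemma distr_transpose:
  assumes "i < n" "k < n"
  shows "distr M M (\<lambda>x. \<lambda>l\<in>{..<n}. x (Transposition.transpose i k l)) = M"
proof (rule P.PiM_eqI)
  let ?t = "Transposition.transpose i k"
  have t: "?t l < n \<longleftrightarrow> l < n" for l
    using assms by (auto simp: Transposition.transpose_def)
  have [measurable]: "(\<lambda>x. \<lambda>l\<in>{..<n}. x (?t l)) \<in> measurable M M"
    by (intro measurable_restrict measurable_component_singleton) (use t in auto)
  fix A :: "nat \<Rightarrow> real set"
  assume A: "\<And>i. i \<in> {..<n} \<Longrightarrow> A i \<in> sets lborel"
  have PA: "Pi\<^sub>E {..<n} A \<in> sets M"
    using A by (intro sets_PiM_I_finite) auto
  have "(\<lambda>x. \<lambda>l\<in>{..<n}. x (?t l)) -` Pi\<^sub>E {..<n} A \<inter> space M = Pi\<^sub>E {..<n} (\<lambda>l. A (?t l))"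
  proof (intro set_eqI iffI)
    fix x assume "x \<in> (\<lambda>x. \<lambda>l\<in>{..<n}. x (?t l)) -` Pi\<^sub>E {..<n} A \<inter> space M"
    then have x: "x \<in> space M" "\<And>l. l < n \<Longrightarrow> x (?t l) \<in> A l"
      by (auto simp: PiE_iff)
    have "x l \<in> A (?t l)" if "l < n" for l
      using x(2)[of "?t l"] t that by simp
    with x(1) show "x \<in> Pi\<^sub>E {..<n} (\<lambda>l. A (?t l))"
      by (auto simp: space_PiM PiE_iff)
  next
    fix x assume x: "x \<in> Pi\<^sub>E {..<n} (\<lambda>l. A (?t l))"
    have "x (?t l) \<in> A l" if "l < n" for l
      using x that t[of l] by (auto simp: PiE_iff dest!: bspec[of _ _ "?t l"])
    with x show "x \<in> (\<lambda>x. \<lambda>l\<in>{..<n}. x (?t l)) -` Pi\<^sub>E {..<n} A \<inter> space M"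
      by (auto simp: space_PiM PiE_iff)
  qed
  then have "emeasure (distr M M (\<lambda>x. \<lambda>l\<in>{..<n}. x (?t l))) (Pi\<^sub>E {..<n} A) = (\<Prod>l<n. emeasure lborel (A (?t l)))"
    using PA A t by (simp add: emeasure_distr, subst P.emeasure_PiM) auto
  also have "\<dots> = (\<Prod>l<n. emeasure lborel (A l))"
    by (rule prod.reindex_bij_witness[of _ ?t ?t]) (use t in auto)
  finally show "emeasure (distr M M (\<lambda>x. \<lambda>l\<in>{..<n}. x (?t l))) (Pi\<^sub>E {..<n} A) = (\<Prod>l<n. emeasure lborel (A l))" .
qed auto

text \<open>Exchanging coordinates shows that all n second moments agree, and they add up to the
  integral of |x|^2 over the unit ball, which is at most its volume.\<close>

lemma nn_integral_coord_sq_le: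
  assumes "i < n"
  shows "(\<integral>\<^sup>+x. ennreal ((x i)\<^sup>2) * indicator {x. nrm x \<le> 1} x \<partial>M) \<le> ennreal (ball_vol / n)"
proof -
  let ?I = "\<lambda>i. \<integral>\<^sup>+x. ennreal ((x i)\<^sup>2) * indicator {x. nrm x \<le> 1} x \<partial>M"
  have eq: "?I k = ?I i" if k: "k < n" for k
  proof -
    let ?T = "\<lambda>x::nat \<Rightarrow> real. \<lambda>l\<in>{..<n}. x (Transposition.transpose i k l)"
    have [measurable]: "?T \<in> measurable M M"
      by (intro measurable_restrict measurable_component_singleton) (use assms k in \<open>auto simp: Transposition.transpose_def\<close>)
    have nrm_T: "nrm (?T x) = nrm x" for x
      unfolding nrm_def using assms k
      by (intro arg_cong[of _ _ sqrt], intro sum.reindex_bij_witness[of _ "Transposition.transpose i k" "Transposition.transpose i k"])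
         (auto simp: Transposition.transpose_def split: if_splits)
    have "?I k = (\<integral>\<^sup>+x. ennreal ((x k)\<^sup>2) * indicator {x. nrm x \<le> 1} x \<partial>distr M M ?T)"
      by (simp only: distr_transpose[OF assms k])
    also have "\<dots> = (\<integral>\<^sup>+x. ennreal ((?T x k)\<^sup>2) * indicator {x. nrm x \<le> 1} (?T x) \<partial>M)"
      using k by (intro nn_integral_distr) auto
    also have "\<dots> = ?I i"
      using k assms by (intro nn_integral_cong) (auto simp: nrm_T indicator_def)
    finally show ?thesis .
  qed
  have "of_nat n * ?I i = (\<Sum>k<n. ?I k)"
    using eq by simp
  also have "\<dots> = (\<integral>\<^sup>+x. (\<Sum>k<n. ennreal ((x k)\<^sup>2) * indicator {x. nrm x \<le> 1} x) \<partial>M)"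
    by (rule nn_integral_sum[symmetric]) measurable
  also have "\<dots> \<le> (\<integral>\<^sup>+x. indicator (cball_n (\<lambda>_. 0) 1) x \<partial>M)"
    by (intro nn_integral_mono)
       (auto simp: cball_n_def indicator_def sum_nonneg power_le_one simp flip: nrm_sq)
  also have "\<dots> = ennreal ball_vol"
    by (simp add: emeasure_cball_n)
  finally have le: "of_nat n * ?I i \<le> ennreal ball_vol" .
  have "?I i = ennreal (1 / n) * (of_nat n * ?I i)"
    by (simp add: mult.assoc[symmetric] ennreal_mult[symmetric] flip: ennreal_of_nat_eq_real_of_nat)
       (simp add: ennreal_of_nat_eq_real_of_nat mult.assoc[symmetric] ennreal_mult[symmetric])
  also have "\<dots> \<le> ennreal (1 / n) * ennreal ball_vol"
    by (intro mult_left_mono le) simp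
  also have "\<dots> = ennreal (ball_vol / n)"
    by (subst ennreal_mult[symmetric]) (auto simp: less_imp_le)
  finally show ?thesis .
qed

text \<open>This is the gain of sqrt n of one coordinate over the full norm. Cauchy-Schwarz appears
  in linearised form, as the arithmetic-geometric inequality with the weight sqrt n that balances
  its two terms.\<close>

lemma nn_integral_abs_coord_le:
  assumes "i < n"
  shows "(\<integral>\<^sup>+x. ennreal \<bar>x i\<bar> * indicator {x. nrm x \<le> 1} x \<partial>M) \<le> ennreal (ball_vol / sqrt n)"
proof -
  have am_gm: "\<bar>t\<bar> \<le> sqrt n / 2 * t\<^sup>2 + 1 / (2 * sqrt n)" for t :: real
  proof -
    have "0 \<le> (sqrt n * \<bar>t\<bar> - 1)\<^sup>2 / (2 * sqrt n)" by simp
    also have "\<dots> = sqrt n / 2 * t\<^sup>2 + 1 / (2 * sqrt n) - \<bar>t\<bar>"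
      by (simp add: power2_eq_square field_simps)
    finally show ?thesis by simp
  qed
  have "(\<integral>\<^sup>+x. ennreal \<bar>x i\<bar> * indicator {x. nrm x \<le> 1} x \<partial>M) \<le>
     (\<integral>\<^sup>+x. ennreal (sqrt n / 2) * (ennreal ((x i)\<^sup>2) * indicator {x. nrm x \<le> 1} x) +
        ennreal (1 / (2 * sqrt n)) * indicator (cball_n (\<lambda>_. 0) 1) x \<partial>M)"
  proof (rule nn_integral_mono)
    fix x assume "x \<in> space M"
    then show "ennreal \<bar>x i\<bar> * indicator {x. nrm x \<le> 1} x \<le>
        ennreal (sqrt n / 2) * (ennreal ((x i)\<^sup>2) * indicator {x. nrm x \<le> 1} x) +
        ennreal (1 / (2 * sqrt n)) * indicator (cball_n (\<lambda>_. 0) 1) x"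
      using am_gm[of "x i"]
      by (auto simp: indicator_def cball_n_def simp flip: ennreal_mult ennreal_plus intro!: ennreal_leI)
  qed
  also have "\<dots> = ennreal (sqrt n / 2) * (\<integral>\<^sup>+x. ennreal ((x i)\<^sup>2) * indicator {x. nrm x \<le> 1} x \<partial>M) +
        ennreal (1 / (2 * sqrt n)) * ennreal ball_vol"
    using assms by (subst nn_integral_add) (auto simp: nn_integral_cmult emeasure_cball_n)
  also have "\<dots> \<le> ennreal (sqrt n / 2) * ennreal (ball_vol / n) + ennreal (1 / (2 * sqrt n)) * ennreal ball_vol"
    by (intro add_mono mult_left_mono nn_integral_coord_sq_le assms) auto
  also have "\<dots> = ennreal (sqrt n / 2 * (ball_vol / n) + 1 / (2 * sqrt n) * ball_vol)"
    using ennreal_mult[of "sqrt n / 2" "ball_vol / n"] ennreal_mult[of "1 / (2 * sqrt n)" ball_vol]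
      ennreal_plus[of "sqrt n / 2 * (ball_vol / n)" "1 / (2 * sqrt n) * ball_vol"]
    by (simp only: ball_vol_pos less_imp_le mult_nonneg_nonneg divide_nonneg_nonneg real_sqrt_ge_zero of_nat_0_le_iff
         zero_le_numeral zero_le_one)
  also have "sqrt n / 2 * (ball_vol / n) + 1 / (2 * sqrt n) * ball_vol = ball_vol / sqrt n"
    by (simp add: field_simps)
  finally show ?thesis .
qed

lemma nn_integral_coord_radial_le:
  assumes [measurable]: "F \<in> borel_measurable borel" and F: "\<And>\<rho>. 0 \<le> F \<rho>" and i: "i < n"
  shows "(\<integral>\<^sup>+x. ennreal (\<bar>x i\<bar> * F (nrm x)) \<partial>M) \<le>
    ennreal ((n + 1) * (ball_vol / sqrt n)) * (\<integral>\<^sup>+\<rho>. ennreal (\<rho> ^ n * F \<rho>) * indicator {0<..} \<rho> \<partial>lborel)"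
proof -
  have "(\<integral>\<^sup>+x. ennreal (\<bar>x i\<bar> * F (nrm x)) \<partial>M) =
      ennreal (n + 1) * (\<integral>\<^sup>+x. ennreal \<bar>x i\<bar> * indicator {x. nrm x \<le> 1} x \<partial>M) *
      (\<integral>\<^sup>+\<rho>. ennreal (\<rho> ^ (n + 1 - 1) * F \<rho>) * indicator {0<..} \<rho> \<partial>lborel)"
    using i F nn_integral_homogeneous_radial[of "\<lambda>x. \<bar>x i\<bar>" F 1] by (simp add: abs_mult)
  also have "\<dots> \<le> ennreal (n + 1) * ennreal (ball_vol / sqrt n) *
      (\<integral>\<^sup>+\<rho>. ennreal (\<rho> ^ (n + 1 - 1) * F \<rho>) * indicator {0<..} \<rho> \<partial>lborel)"
    by (intro mult_right_mono mult_left_mono nn_integral_abs_coord_le i) auto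
  also have "ennreal (n + 1) * ennreal (ball_vol / sqrt n) = ennreal ((n + 1) * (ball_vol / sqrt n))"
    by (rule ennreal_mult[symmetric]) (auto simp: less_imp_le)
  finally show ?thesis by simp
qed

end

section \<open>Size and smoothness of the regularized kernel\<close>

text \<open>The ratio b / a is within 1 / (4 n) of 1, and Bernoulli bounds both (b / a)^(n + 1) and
  its inverse from below by 1 - (n + 1) r / a. That these bounds stay away from 0 is the reason for
  the outer radius 4 n r.\<close>

lemma inverse_power_diff_bounds:
  fixes a b r :: real and n :: nat
  assumes n: "2 \<le> n" and r: "0 < r" and a: "4 * n * r < a" and ab: "\<bar>a - b\<bar> \<le> r"
  shows "0 < b" "1 / b ^ (n + 1) \<le> 2 / a ^ (n + 1)"
    "\<bar>1 / b ^ (n + 1) - 1 / a ^ (n + 1)\<bar> \<le> 2 * (n + 1) * r / a ^ (n + 2)"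
proof -
  have "8 * r \<le> 4 * n * r" using n r by simp
  with a r have a_pos: "0 < a" "8 * r < a" by linarith+
  show b: "0 < b" using ab a_pos r by linarith
  define d where "d = r / a"
  define u where "u = (b / a) ^ (n + 1)"
  have d: "0 < d" "d < 1" using a_pos r by (auto simp: d_def)
  \<comment> \<open>From d < 1 / (4 n) and n + 1 <= 3 n / 2.\<close>
  have "(n + 1) * d \<le> 3 / 8"
  proof -
    have "real n * (8 * r) < 2 * a" using a by (simp add: mult_ac)
    moreover have "8 * r * (n + 1) \<le> 12 * n * r" using n r by (simp add: algebra_simps)
    ultimately show ?thesis using a_pos by (simp add: d_def field_simps)
  qed
  then have nd: "5 / 8 \<le> 1 - (n + 1) * d" by simp
  have pw: "1 - (n + 1) * d \<le> t ^ (n + 1)" if "1 - d \<le> t" for t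
  proof -
    have "1 + real (n + 1) * (- d) \<le> (1 + (- d)) ^ (n + 1)"
      using d by (intro Bernoulli_inequality) simp
    also have "\<dots> \<le> t ^ (n + 1)" using that d by (intro power_mono) auto
    finally show ?thesis by (simp add: algebra_simps)
  qed
  have u: "1 - (n + 1) * d \<le> u"
  proof -
    have "(a - r) / a \<le> b / a" using ab a_pos by (intro divide_right_mono) auto
    then show ?thesis
      unfolding u_def using a_pos by (intro pw) (simp add: d_def diff_divide_distrib)
  qed
  have "1 - d \<le> a / b"
  proof -
    have "a * (1 + d) = a + r" using a_pos by (simp add: d_def distrib_left)
    then have "(1 - d) * b \<le> (1 - d) * (a * (1 + d))"
      using ab d by (intro mult_left_mono) auto
    also have "\<dots> \<le> a" using a_pos by (simp add: algebra_simps)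
    finally show ?thesis using b by (simp add: field_simps)
  qed
  from pw[OF this] have u': "1 - (n + 1) * d \<le> 1 / u"
    by (simp add: u_def power_divide)
  have u_pos: "0 < u" using u nd by linarith
  have b_eq: "1 / b ^ (n + 1) = (1 / u) / a ^ (n + 1)"
    using a_pos b by (simp add: u_def power_divide)
  have "1 / u \<le> 2" using u nd u_pos by (simp add: field_simps)
  then show "1 / b ^ (n + 1) \<le> 2 / a ^ (n + 1)"
    unfolding b_eq using a_pos by (intro divide_right_mono) auto
  have "\<bar>1 / u - 1\<bar> \<le> 2 * ((n + 1) * d)"
  proof (cases "u \<le> 1")
    case True
    have "1 - u \<le> (n + 1) * d" using u by simp
    also have "\<dots> \<le> 2 * ((n + 1) * d) * u"
      using mult_left_mono[of "1/2" u "(n + 1) * d"] u nd d by (simp add: mult_ac)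
    finally have "1 / u - 1 \<le> 2 * ((n + 1) * d)" using u_pos by (simp add: field_simps)
    with True u_pos show ?thesis by (simp add: field_simps)
  next
    case False
    then have "1 / u \<le> 1" by simp
    then have "\<bar>1 / u - 1\<bar> \<le> (n + 1) * d" using u' by simp
    also have "\<dots> \<le> 2 * ((n + 1) * d)" using d by simp
    finally show ?thesis .
  qed
  then have "\<bar>1 / u - 1\<bar> / a ^ (n + 1) \<le> 2 * ((n + 1) * d) / a ^ (n + 1)"
    using a_pos by (intro divide_right_mono) auto
  also have "2 * ((n + 1) * d) / a ^ (n + 1) = 2 * (n + 1) * r / a ^ (n + 2)"
    using a_pos by (simp add: d_def)
  also have "\<bar>1 / u - 1\<bar> / a ^ (n + 1) = \<bar>1 / b ^ (n + 1) - 1 / a ^ (n + 1)\<bar>"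
    unfolding b_eq diff_divide_distrib[symmetric] abs_divide using a_pos by simp
  finally show "\<bar>1 / b ^ (n + 1) - 1 / a ^ (n + 1)\<bar> \<le> 2 * (n + 1) * r / a ^ (n + 2)" .
qed

context euclid_dim
begin

section \<open>The normalising constant and the regularized kernels\<close>

definition riesz_const :: real where
  "riesz_const = Gamma ((real n + 1) / 2) / pi powr ((real n + 1) / 2)"

lemma riesz_const_pos [simp]: "0 < riesz_const"
  by (simp add: riesz_const_def Gamma_real_pos)

text \<open>The powers of pi leave only 1 / sqrt pi times the quotient of Gamma at (n + 1) / 2 and
  at n / 2 + 1. \<open>Gamma_half_ratio\<close> with x = n / 2 bounds the quotient by sqrt (2 / n),
  and 2 / pi is below 1.\<close>

lemma riesz_const_ball_vol: "riesz_const * ball_vol \<le> 1 / sqrt n"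
proof -
  have G: "0 < Gamma (real n / 2 + 1)" by (simp add: Gamma_real_pos add_pos_pos)
  have "(Gamma ((real n + 1) / 2))\<^sup>2 \<le> (Gamma (real n / 2 + 1))\<^sup>2 / (real n / 2)"
    using Gamma_half_ratio[of "real n / 2"] by (simp add: add_divide_distrib)
  then have "(Gamma ((real n + 1) / 2))\<^sup>2 / (Gamma (real n / 2 + 1))\<^sup>2 \<le> 2 / n"
    using G by (subst divide_le_eq) (auto simp: mult_ac)
  then have "(Gamma ((real n + 1) / 2) / Gamma (real n / 2 + 1))\<^sup>2 \<le> 2 / n"
    by (simp add: power_divide)
  then have "Gamma ((real n + 1) / 2) / Gamma (real n / 2 + 1) \<le> sqrt (2 / n)"
    by (rule real_le_rsqrt)
  then have "Gamma ((real n + 1) / 2) / Gamma (real n / 2 + 1) / sqrt pi \<le> sqrt (2 / n) / sqrt pi"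
    by (intro divide_right_mono) auto
  also have "\<dots> = sqrt (2 / pi) / sqrt n"
    by (simp add: real_sqrt_divide)
  also have "\<dots> \<le> 1 / sqrt n"
    using pi_gt3 by (intro divide_right_mono) auto
  finally have 1: "Gamma ((real n + 1) / 2) / Gamma (real n / 2 + 1) / sqrt pi \<le> 1 / sqrt n" .
  have "pi powr ((real n + 1) / 2) = pi powr (n / 2) * sqrt pi"
    by (simp add: powr_add[symmetric] powr_half_sqrt[symmetric] add_divide_distrib)
  then have "riesz_const * ball_vol = Gamma ((real n + 1) / 2) / Gamma (real n / 2 + 1) / sqrt pi"
    by (simp add: riesz_const_def ball_vol_def unit_ball_vol_def)
  with 1 show ?thesis by simp
qed

text \<open>The Euclidean length of (z, e) in dimension n + 1. The parameter e is the height in the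
  upper half-space on which the Riesz and Poisson kernels are conjugate.\<close>

definition reg :: "real \<Rightarrow> (nat \<Rightarrow> real) \<Rightarrow> real" where
  "reg e z = sqrt ((nrm z)\<^sup>2 + e\<^sup>2)"

definition riesz_kernel :: "real \<Rightarrow> nat \<Rightarrow> (nat \<Rightarrow> real) \<Rightarrow> real" where
  "riesz_kernel e i z = riesz_const * z i / reg e z ^ (n + 1)"

definition poisson_kernel :: "real \<Rightarrow> (nat \<Rightarrow> real) \<Rightarrow> real" where
  "poisson_kernel e z = riesz_const * e / reg e z ^ (n + 1)"

lemma reg_pos: "0 < e \<Longrightarrow> 0 < reg e z"
  by (simp add: reg_def add_nonneg_pos)

lemma nrm_le_reg: "nrm z \<le> reg e z"
  by (auto simp: reg_def intro: real_le_rsqrt)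

lemma le_reg: "0 < e \<Longrightarrow> e \<le> reg e z"
  by (auto simp: reg_def intro: real_le_rsqrt)

lemma reg_cong: "(\<And>i. i < n \<Longrightarrow> x i = y i) \<Longrightarrow> reg e x = reg e y"
  using nrm_cong[of x y] by (simp add: reg_def)

text \<open>Minkowski's inequality in the plane for the vectors (|x - y|, e) and (|y|, 0). The
  Lipschitz constant is therefore 1 for every e.\<close>

lemma reg_triangle: "reg e x \<le> reg e (\<lambda>i. x i - y i) + nrm y"
proof -
  have "nrm x \<le> nrm (\<lambda>i. x i - y i) + nrm y"
    using nrm_triangle[of "\<lambda>i. x i - y i" y] by simp
  then have "reg e x \<le> sqrt ((nrm (\<lambda>i. x i - y i) + nrm y)\<^sup>2 + (e + 0)\<^sup>2)"
    unfolding reg_def by (simp add: power_mono)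
  also have "\<dots> \<le> reg e (\<lambda>i. x i - y i) + sqrt ((nrm y)\<^sup>2 + 0\<^sup>2)"
    unfolding reg_def by (rule real_sqrt_sum_squares_triangle_ineq)
  finally show ?thesis by simp
qed

lemma abs_reg_diff: "\<bar>reg e x - reg e (\<lambda>i. x i - y i)\<bar> \<le> nrm y"
  using reg_triangle[of e x y] reg_triangle[of e "\<lambda>i. x i - y i" "\<lambda>i. - y i"]
  by (simp add: nrm_uminus)

lemma measurable_reg [measurable (raw)]:
  assumes "\<And>i. i < n \<Longrightarrow> (\<lambda>w. f w i) \<in> borel_measurable N"
  shows "(\<lambda>w. reg e (f w)) \<in> borel_measurable N"
  using assms unfolding reg_def by measurable

lemma measurable_riesz_kernel [measurable (raw)]:
  assumes "\<And>i. i < n \<Longrightarrow> (\<lambda>w. f w i) \<in> borel_measurable N" "i < n"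
  shows "(\<lambda>w. riesz_kernel e i (f w)) \<in> borel_measurable N"
  using assms unfolding riesz_kernel_def by measurable

lemma measurable_poisson_kernel [measurable (raw)]:
  assumes "\<And>i. i < n \<Longrightarrow> (\<lambda>w. f w i) \<in> borel_measurable N"
  shows "(\<lambda>w. poisson_kernel e (f w)) \<in> borel_measurable N"
  using assms unfolding poisson_kernel_def by measurable

text \<open>Multiplied by \<open>riesz_const * e\<close>, this bounds the mass of the Poisson kernel
  by pi. The exact mass is 1; what matters is a bound free of n and e.\<close>

lemma nn_integral_reg_le:
  assumes e: "0 < e"
  shows "(\<integral>\<^sup>+x. ennreal (1 / reg e x ^ (n + 1)) \<partial>M) \<le> ennreal (pi / (riesz_const * e))"
proof -
  let ?F = "\<lambda>\<rho>. 1 / sqrt (\<rho>\<^sup>2 + e\<^sup>2) ^ (n + 1)"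
  have "(\<integral>\<^sup>+\<rho>. ennreal (\<rho> ^ (n - 1) * ?F \<rho>) * indicator {0<..} \<rho> \<partial>lborel) \<le>
      (\<integral>\<^sup>+\<rho>. ennreal (1 / (\<rho>\<^sup>2 + (sqrt n / 2 * e)\<^sup>2)) * indicator {0<..} \<rho> \<partial>lborel)"
    using power_ratio_le[OF _ e] by (intro nn_integral_mono) (auto simp: indicator_def intro!: ennreal_leI)
  also have "\<dots> = ennreal (pi / (2 * (sqrt n / 2 * e)))"
    using e by (intro nn_integral_inverse_square_plus) auto
  finally have 1: "(\<integral>\<^sup>+\<rho>. ennreal (\<rho> ^ (n - 1) * ?F \<rho>) * indicator {0<..} \<rho> \<partial>lborel) \<le>
      ennreal (pi / (sqrt n * e))" by simp
  have "(\<integral>\<^sup>+x. ennreal (1 / reg e x ^ (n + 1)) \<partial>M) = ennreal (n * ball_vol) *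
      (\<integral>\<^sup>+\<rho>. ennreal (\<rho> ^ (n - 1) * ?F \<rho>) * indicator {0<..} \<rho> \<partial>lborel)"
    unfolding reg_def by (rule nn_integral_radial) auto
  also have "\<dots> \<le> ennreal (n * ball_vol) * ennreal (pi / (sqrt n * e))"
    by (intro mult_left_mono 1) auto
  also have "\<dots> = ennreal (n * ball_vol * (pi / (sqrt n * e)))"
    using e by (intro ennreal_mult[symmetric]) (auto simp: less_imp_le)
  also have "\<dots> \<le> ennreal (pi / (riesz_const * e))"
  proof (rule ennreal_leI)
    have "n * ball_vol * (pi / (sqrt n * e)) = (riesz_const * ball_vol * sqrt n) * (pi / (riesz_const * e))"
      using e less_imp_neq[OF riesz_const_pos] by (simp add: field_simps)
    also have "\<dots> \<le> 1 * (pi / (riesz_const * e))"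
      using riesz_const_ball_vol e
      by (intro mult_right_mono) (auto simp: field_simps less_imp_le)
    finally show "n * ball_vol * (pi / (sqrt n * e)) \<le> pi / (riesz_const * e)" by simp
  qed
  finally show ?thesis .
qed

text \<open>One factor 1 / sqrt n comes from the normalising constant and one from the coordinate;
  together they pay for the factor n + 1 of the polar integral.\<close>

lemma riesz_const_moment: "riesz_const * ((n + 1) * (ball_vol / sqrt n)) \<le> 3 / 2"
proof -
  have "riesz_const * ((n + 1) * (ball_vol / sqrt n)) = (n + 1) / sqrt n * (riesz_const * ball_vol)"
    by simp
  also have "\<dots> \<le> (n + 1) / sqrt n * (1 / sqrt n)"
    by (intro mult_left_mono riesz_const_ball_vol) auto
  also have "\<dots> = (n + 1) / n" by simp
  also have "\<dots> \<le> 3 / 2" using n2 by (simp add: field_simps)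
  finally show ?thesis .
qed

lemma nn_integral_coord_le_scaled:
  assumes [measurable]: "F \<in> borel_measurable borel" and F: "\<And>\<rho>. 0 \<le> F \<rho>" and i: "i < n"
    and J: "(\<integral>\<^sup>+\<rho>. ennreal (\<rho> ^ n * F \<rho>) * indicator {0<..} \<rho> \<partial>lborel) \<le> ennreal J" "0 \<le> J"
  shows "(\<integral>\<^sup>+x. ennreal (riesz_const * (\<bar>x i\<bar> * F (nrm x))) \<partial>M) \<le> ennreal (3 / 2 * J)"
proof -
  have "(\<integral>\<^sup>+x. ennreal (riesz_const * (\<bar>x i\<bar> * F (nrm x))) \<partial>M) =
      ennreal riesz_const * (\<integral>\<^sup>+x. ennreal (\<bar>x i\<bar> * F (nrm x)) \<partial>M)"
    using i F by (subst nn_integral_cmult[symmetric]) (auto simp: ennreal_mult less_imp_le)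
  also have "\<dots> \<le> ennreal riesz_const * (ennreal ((n + 1) * (ball_vol / sqrt n)) * ennreal J)"
    by (intro mult_left_mono order_trans[OF nn_integral_coord_radial_le[OF assms(1) F i]] J) auto
  also have "\<dots> = ennreal (riesz_const * ((n + 1) * (ball_vol / sqrt n)) * J)"
    using J(2) by (subst ennreal_mult[symmetric] | auto simp: less_imp_le mult.assoc)+
  also have "\<dots> \<le> ennreal (3 / 2 * J)"
    using riesz_const_moment J(2) by (intro ennreal_leI mult_right_mono) auto
  finally show ?thesis .
qed

lemma nn_integral_annulus_le:
  assumes ab: "0 < a" "a \<le> b" and i: "i < n"
  shows "(\<integral>\<^sup>+x. ennreal (riesz_const * (\<bar>x i\<bar> * (indicator {a..b} (nrm x) / nrm x ^ (n + 1)))) \<partial>M)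
    \<le> ennreal (3 / 2 * ln (b / a))"
proof (rule nn_integral_coord_le_scaled[where F = "\<lambda>\<rho>. indicator {a..b} \<rho> / \<rho> ^ (n + 1)"])
  show "0 \<le> indicator {a..b} \<rho> / \<rho> ^ (n + 1)" for \<rho> :: real
    using ab by (auto simp: indicator_def)
  have "(\<integral>\<^sup>+\<rho>. ennreal (\<rho> ^ n * (indicator {a..b} \<rho> / \<rho> ^ (n + 1))) * indicator {0<..} \<rho> \<partial>lborel) =
      (\<integral>\<^sup>+\<rho>. ennreal (1 / \<rho>) * indicator {a..b} \<rho> \<partial>lborel)"
    using ab by (intro nn_integral_cong) (auto simp: indicator_def)
  also have "\<dots> = ennreal (ln b - ln a)"
    using ab by (intro nn_integral_FTC_Icc) (auto intro!: derivative_eq_intros)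
  finally show "(\<integral>\<^sup>+\<rho>. ennreal (\<rho> ^ n * (indicator {a..b} \<rho> / \<rho> ^ (n + 1))) * indicator {0<..} \<rho> \<partial>lborel) \<le> ennreal (ln (b / a))"
    using ab by (simp add: ln_divide_pos)
  show "0 \<le> ln (b / a)" using ab by simp
qed (use i in auto)

lemma nn_integral_coord_tail_le:
  assumes R: "0 < R" and i: "i < n"
  shows "(\<integral>\<^sup>+x. ennreal (riesz_const * (\<bar>x i\<bar> * (indicator {R..} (nrm x) / nrm x ^ (n + 2)))) \<partial>M)
    \<le> ennreal (3 / 2 * (1 / R))"
proof (rule nn_integral_coord_le_scaled[where F = "\<lambda>\<rho>. indicator {R..} \<rho> / \<rho> ^ (n + 2)"])
  show "0 \<le> indicator {R..} \<rho> / \<rho> ^ (n + 2)" for \<rho> :: real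
    using R by (auto simp: indicator_def)
  have "(\<integral>\<^sup>+\<rho>. ennreal (\<rho> ^ n * (indicator {R..} \<rho> / \<rho> ^ (n + 2))) * indicator {0<..} \<rho> \<partial>lborel) =
      (\<integral>\<^sup>+\<rho>. ennreal (1 / \<rho> ^ (1 + 1)) * indicator {R..} \<rho> \<partial>lborel)"
    using R by (intro nn_integral_cong) (auto simp: indicator_def)
  also have "\<dots> = ennreal (1 / R)"
    using nn_integral_power_tail[of R 1] R by simp
  finally show "(\<integral>\<^sup>+\<rho>. ennreal (\<rho> ^ n * (indicator {R..} \<rho> / \<rho> ^ (n + 2))) * indicator {0<..} \<rho> \<partial>lborel) \<le> ennreal (1 / R)"
    by simp
qed (use i R in auto)

text \<open>With no coordinate to average over, one of the two factors 1 / sqrt n is missing and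
  sqrt n survives. It is harmless, because the integral is used with R = 4 n r and the prefactor 2
  r.\<close>

lemma nn_integral_tail_le:
  assumes R: "0 < R"
  shows "(\<integral>\<^sup>+x. ennreal (riesz_const * (indicator {R..} (nrm x) / nrm x ^ (n + 1))) \<partial>M) \<le> ennreal (sqrt n / R)"
proof -
  let ?F = "\<lambda>\<rho>. riesz_const * (indicator {R..} \<rho> / \<rho> ^ (n + 1))"
  have "(\<integral>\<^sup>+\<rho>. ennreal (\<rho> ^ (n - 1) * ?F \<rho>) * indicator {0<..} \<rho> \<partial>lborel) =
      (\<integral>\<^sup>+\<rho>. ennreal riesz_const * (ennreal (1 / \<rho> ^ (1 + 1)) * indicator {R..} \<rho>) \<partial>lborel)"
  proof (rule nn_integral_cong)
    fix \<rho> :: real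
    have e: "n + 1 = (n - 1) + 2" using n_pos(1) by linarith
    have "\<rho> ^ (n - 1) * (riesz_const * (1 / \<rho> ^ (n + 1))) = riesz_const * (1 / \<rho> ^ 2)" if "0 < \<rho>"
      using that unfolding e power_add by simp
    then show "ennreal (\<rho> ^ (n - 1) * ?F \<rho>) * indicator {0<..} \<rho> =
        ennreal riesz_const * (ennreal (1 / \<rho> ^ (1 + 1)) * indicator {R..} \<rho>)"
      using R by (auto simp: indicator_def less_imp_le power2_eq_square simp flip: ennreal_mult)
  qed
  also have "\<dots> = ennreal (riesz_const / R)"
    using nn_integral_power_tail[of R 1] R
    by (simp add: nn_integral_cmult less_imp_le flip: ennreal_mult)
  finally have 1: "(\<integral>\<^sup>+\<rho>. ennreal (\<rho> ^ (n - 1) * ?F \<rho>) * indicator {0<..} \<rho> \<partial>lborel) = ennreal (riesz_const / R)" .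
  have "(\<integral>\<^sup>+x. ennreal (?F (nrm x)) \<partial>M) = ennreal (n * ball_vol) * ennreal (riesz_const / R)"
    unfolding 1[symmetric] using R
    by (intro nn_integral_radial) (auto simp: indicator_def less_imp_le)
  also have "\<dots> = ennreal (n * ball_vol * (riesz_const / R))"
    using R by (intro ennreal_mult[symmetric]) (auto simp: less_imp_le)
  also have "\<dots> \<le> ennreal (sqrt n / R)"
  proof (rule ennreal_leI)
    have "n * ball_vol * (riesz_const / R) = n * (riesz_const * ball_vol) / R" by simp
    also have "\<dots> \<le> n * (1 / sqrt n) / R"
      using R by (intro divide_right_mono mult_left_mono riesz_const_ball_vol) auto
    also have "n * (1 / sqrt n) / R = sqrt n / R" by (simp add: real_div_sqrt)
    finally show "n * ball_vol * (riesz_const / R) \<le> sqrt n / R" .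
  qed
  finally show ?thesis .
qed

end

lemma ennreal_four_terms:
  assumes "0 \<le> s" "0 \<le> t" "0 \<le> c" "0 \<le> u" "0 \<le> d" "0 \<le> v"
  shows "ennreal (s + t + (c * u + d * v)) = (ennreal s + ennreal t) + (ennreal c * ennreal u + ennreal d * ennreal v)"
  using assms by (simp add: ennreal_plus ennreal_mult)

context euclid_dim
begin

section \<open>Comparison of a kernel with its translates\<close>

lemma abs_riesz_kernel_le:
  assumes "0 < nrm z"
  shows "\<bar>riesz_kernel e i z\<bar> \<le> riesz_const * (\<bar>z i\<bar> * (1 / nrm z ^ (n + 1)))"
proof -
  have "\<bar>riesz_kernel e i z\<bar> = riesz_const * (\<bar>z i\<bar> * (1 / reg e z ^ (n + 1)))"
    using order_less_le_trans[OF assms nrm_le_reg[of z e]]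
    by (simp add: riesz_kernel_def abs_mult abs_divide less_imp_le)
  also have "\<dots> \<le> riesz_const * (\<bar>z i\<bar> * (1 / nrm z ^ (n + 1)))"
    using assms order_less_le_trans[OF assms nrm_le_reg[of z e]]
    by (intro mult_left_mono divide_left_mono power_mono nrm_le_reg mult_pos_pos zero_less_power) (auto simp: less_imp_le)
  finally show ?thesis .
qed

text \<open>The difference of inverse powers keeps its factor |x_i|, since replacing it by |x| would
  lose the averaging gain of sqrt n. The part with y_i has no coordinate of x to average, but
  carries no factor n + 1 either.\<close>

lemma riesz_kernel_diff_le:
  fixes r :: real
  assumes e: "0 < e" and r: "0 < r" and y: "nrm y \<le> r" and x: "4 * n * r < nrm x" and i: "i < n"
  shows "\<bar>riesz_kernel e i (\<lambda>l. x l - y l) - riesz_kernel e i x\<bar> \<le>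
    2 * r * (riesz_const * (1 / nrm x ^ (n + 1))) +
    2 * (n + 1) * r * (riesz_const * (\<bar>x i\<bar> * (1 / nrm x ^ (n + 2))))"
proof -
  let ?a = "reg e x" and ?b = "reg e (\<lambda>l. x l - y l)"
  have a: "4 * n * r < ?a" using x nrm_le_reg[of x e] by linarith
  have ab: "\<bar>?a - ?b\<bar> \<le> r" using abs_reg_diff[of e x y] y by linarith
  note bd = inverse_power_diff_bounds[OF n2 r a ab]
  have "0 \<le> 4 * n * r" using r by simp
  with x have xp: "0 < nrm x" by linarith
  have mono: "1 / ?a ^ k \<le> 1 / nrm x ^ k" for k
    using xp order_less_le_trans[OF xp nrm_le_reg[of x e]]
    by (intro divide_left_mono power_mono nrm_le_reg mult_pos_pos zero_less_power) auto
  have "riesz_kernel e i (\<lambda>l. x l - y l) - riesz_kernel e i x =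
      riesz_const * (x i * (1 / ?b ^ (n + 1) - 1 / ?a ^ (n + 1)) - y i * (1 / ?b ^ (n + 1)))"
  proof -
    have "riesz_kernel e i z = riesz_const * (z i * (1 / reg e z ^ (n + 1)))" for z
      by (simp add: riesz_kernel_def)
    then show ?thesis by (simp only: algebra_simps)
  qed
  then have "\<bar>riesz_kernel e i (\<lambda>l. x l - y l) - riesz_kernel e i x\<bar> \<le>
      riesz_const * (\<bar>x i\<bar> * \<bar>1 / ?b ^ (n + 1) - 1 / ?a ^ (n + 1)\<bar> + \<bar>y i\<bar> * (1 / ?b ^ (n + 1)))"
    using bd(1) by (simp add: abs_mult less_imp_le mult_left_mono abs_triangle_ineq4[THEN order_trans])
  also have "\<dots> \<le> riesz_const * (\<bar>x i\<bar> * (2 * (n + 1) * r * (1 / nrm x ^ (n + 2))) + r * (2 * (1 / nrm x ^ (n + 1))))"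
  proof (intro mult_left_mono add_mono mult_mono)
    have "2 * (n + 1) * r / ?a ^ (n + 2) \<le> 2 * (n + 1) * r * (1 / nrm x ^ (n + 2))"
      using mult_left_mono[OF mono[of "n + 2"], of "2 * (n + 1) * r"] r by simp
    then show "\<bar>1 / ?b ^ (n + 1) - 1 / ?a ^ (n + 1)\<bar> \<le> 2 * (n + 1) * r * (1 / nrm x ^ (n + 2))"
      using bd(3) by linarith
    show "1 / ?b ^ (n + 1) \<le> 2 * (1 / nrm x ^ (n + 1))"
      using bd(2) mono[of "n + 1"] by (simp only: times_divide_eq_right mult_1_right)
    show "\<bar>y i\<bar> \<le> r" using abs_coord_le_nrm[OF i, of y] y by linarith
  qed (use r bd(1) in \<open>auto simp: less_imp_le\<close>)
  also have "\<dots> = 2 * r * (riesz_const * (1 / nrm x ^ (n + 1))) +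
    2 * (n + 1) * r * (riesz_const * (\<bar>x i\<bar> * (1 / nrm x ^ (n + 2))))"
    by (simp add: algebra_simps)
  finally show ?thesis .
qed

text \<open>Accounting for the 15: since (4 n + 1) n <= n^5 and 4 n <= n^3, the logarithms give 3/2
  * 5 + 3/2 * 3 = 12 times ln n; the additive 13 / 8 is below 3 ln n because ln 2 >= 2 / 3.\<close>

lemma far_constants:
  "3 / 2 * ln ((4 * n + 1) * n) + 3 / 2 * ln (4 * n) + 1 / 2 + 9 / 8 \<le> 15 * ln n"
proof -
  have n: "2 \<le> real n" using n2 by simp
  have n2': "4 \<le> real n ^ 2" using power_mono[of 2 "real n" 2] n by simp
  have "4 * real n + 1 \<le> real n ^ 4"
  proof -
    have "4 * real n + 1 \<le> 4 * real n ^ 2"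
    proof -
      have "2 * real n \<le> real n * real n" using n by (intro mult_right_mono) auto
      then show ?thesis unfolding power2_eq_square using n by linarith
    qed
    also have "\<dots> \<le> real n ^ 2 * real n ^ 2" using n2' by (intro mult_right_mono) auto
    finally show ?thesis by (simp flip: power_add)
  qed
  then have "(4 * real n + 1) * n \<le> real n ^ 5"
    using mult_right_mono[of "4 * real n + 1" "real n ^ 4" "real n"] by (simp add: eval_nat_numeral mult_ac)
  then have "ln ((4 * real n + 1) * n) \<le> ln (real n ^ 5)"
    using n by (subst ln_le_cancel_iff) auto
  then have 1: "ln ((4 * n + 1) * n) \<le> 5 * ln n"
    using n by (simp add: ln_realpow algebra_simps)
  have "4 * real n \<le> real n ^ 3"
    using mult_right_mono[OF n2', of "real n"] by (simp add: eval_nat_numeral mult_ac)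
  then have "ln (4 * real n) \<le> ln (real n ^ 3)"
    using n by (subst ln_le_cancel_iff) auto
  then have 2: "ln (4 * n) \<le> 3 * ln n"
    using n by (simp add: ln_realpow)
  have "2 / 3 \<le> ln (2::real)" using ln2_ge_two_thirds .
  also have "\<dots> \<le> ln n" using n by simp
  finally show ?thesis using 1 2 by simp
qed

text \<open>Up to |x| = 4 n r the two kernels are bounded separately and each costs a logarithm;
  beyond it their difference costs an absolute constant. The dilation 1 + 1/n keeps |x - y| above
  r/n, which is the inner radius of the annulus for the translated kernel.\<close>

lemma riesz_kernel_far:
  fixes r :: real
  assumes e: "0 < e" and r: "0 < r" and y: "nrm y \<le> r" and i: "i < n"
  shows "(\<integral>\<^sup>+x. ennreal (\<bar>riesz_kernel e i (\<lambda>l. x l - y l) - riesz_kernel e i x\<bar> * indicator {(1 + 1 / n) * r<..} (nrm x)) \<partial>M)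
     \<le> ennreal (15 * ln n)"
proof -
  let ?k = "\<lambda>S p z. riesz_const * (\<bar>z i\<bar> * (indicator S (nrm z) / nrm z ^ p))"
  let ?R = "4 * n * r"
  let ?A1 = "{r / n .. (4 * n + 1) * r}" and ?A2 = "{r .. ?R}"
  have n: "2 \<le> real n" using n2 by simp
  have nr: "r \<le> ?R" "0 < ?R" "r / n \<le> (4 * n + 1) * r" "0 < r / n"
  proof -
    have "1 * r \<le> real (4 * n) * r" "1 * r \<le> real (4 * n + 1) * r"
      using n r by (intro mult_right_mono; simp)+
    moreover have "r / n \<le> r / 1" using n r by (intro divide_left_mono) auto
    ultimately show "r \<le> ?R" "0 < ?R" "r / n \<le> (4 * n + 1) * r" "0 < r / n"
      using r by (auto intro: order_trans)
  qed
  have pt: "\<bar>riesz_kernel e i (\<lambda>l. x l - y l) - riesz_kernel e i x\<bar> * indicator {(1 + 1 / n) * r<..} (nrm x) \<le>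
      ?k ?A1 (n + 1) (\<lambda>l. x l - y l) + ?k ?A2 (n + 1) x +
      (2 * r * (riesz_const * (indicator {?R..} (nrm x) / nrm x ^ (n + 1))) +
       2 * (n + 1) * r * ?k {?R..} (n + 2) x)" (is "?lhs \<le> ?t1 + ?t2 + (?t3 + ?t4)") for x
  proof -
    have nonneg: "0 \<le> ?t1" "0 \<le> ?t2" "0 \<le> ?t3" "0 \<le> ?t4"
      using r by (auto simp: less_imp_le)
    consider "nrm x \<le> (1 + 1 / n) * r" | "(1 + 1 / n) * r < nrm x" "nrm x \<le> ?R" | "?R < nrm x"
      by linarith
    then show ?thesis
    proof cases
      case 1
      then show ?thesis using nonneg by simp
    next
      case 2
      have "(1 + 1 / n) * r = r + r / n" by (simp add: algebra_simps)
      then have xr: "r \<le> nrm x" using 2(1) nr(4) by linarith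
      have "nrm x \<le> nrm (\<lambda>l. x l - y l) + nrm y"
        using nrm_triangle_sub[of x y] by linarith
      then have lo: "r / n \<le> nrm (\<lambda>l. x l - y l)" using 2(1) y by (simp add: algebra_simps)
      have "nrm (\<lambda>l. x l - y l) \<le> nrm x + nrm y" by (rule nrm_diff_le)
      then have hi: "nrm (\<lambda>l. x l - y l) \<le> (4 * n + 1) * r" using 2(2) y by (simp add: algebra_simps)
      have "?lhs \<le> \<bar>riesz_kernel e i (\<lambda>l. x l - y l)\<bar> + \<bar>riesz_kernel e i x\<bar>"
        by (auto simp: indicator_def)
      also have "\<dots> \<le> ?t1 + ?t2"
        using abs_riesz_kernel_le[of "\<lambda>l. x l - y l" e i] abs_riesz_kernel_le[of x e i] lo hi xr 2(2) r nr(4)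
        by (intro add_mono) auto
      finally show ?thesis using nonneg by linarith
    next
      case 3
      have "?lhs \<le> \<bar>riesz_kernel e i (\<lambda>l. x l - y l) - riesz_kernel e i x\<bar>"
        by (auto simp: indicator_def)
      also have "\<dots> \<le> ?t3 + ?t4"
        using riesz_kernel_diff_le[OF e r y 3 i] 3 by simp
      finally show ?thesis using nonneg by linarith
    qed
  qed
  have sh: "(\<integral>\<^sup>+x. ennreal (?k ?A1 (n + 1) (\<lambda>l. x l - y l)) \<partial>M) = (\<integral>\<^sup>+x. ennreal (?k ?A1 (n + 1) x) \<partial>M)"
  proof -
    have eq: "nrm (aff 1 (\<lambda>l. - y l) x) = nrm (\<lambda>l. x l - y l)" for x
      by (intro nrm_cong) simp
    have "(\<integral>\<^sup>+x. ennreal (?k ?A1 (n + 1) (\<lambda>l. x l - y l)) \<partial>M) =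
        (\<integral>\<^sup>+x. ennreal (?k ?A1 (n + 1) (aff 1 (\<lambda>l. - y l) x)) \<partial>M)"
      using i by (simp add: eq)
    also have "\<dots> = (\<integral>\<^sup>+x. ennreal (?k ?A1 (n + 1) x) \<partial>M)"
      using i by (intro nn_integral_shift) measurable
    finally show ?thesis .
  qed
  have "(\<integral>\<^sup>+x. ennreal (\<bar>riesz_kernel e i (\<lambda>l. x l - y l) - riesz_kernel e i x\<bar> * indicator {(1 + 1 / n) * r<..} (nrm x)) \<partial>M)
     \<le> (\<integral>\<^sup>+x. (ennreal (?k ?A1 (n + 1) (\<lambda>l. x l - y l)) + ennreal (?k ?A2 (n + 1) x)) +
         (ennreal (2 * r) * ennreal (riesz_const * (indicator {?R..} (nrm x) / nrm x ^ (n + 1))) +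
          ennreal (2 * (n + 1) * r) * ennreal (?k {?R..} (n + 2) x)) \<partial>M)"
  proof (rule nn_integral_mono)
    fix x
    show "ennreal (\<bar>riesz_kernel e i (\<lambda>l. x l - y l) - riesz_kernel e i x\<bar> * indicator {(1 + 1 / n) * r<..} (nrm x)) \<le>
      (ennreal (?k ?A1 (n + 1) (\<lambda>l. x l - y l)) + ennreal (?k ?A2 (n + 1) x)) +
         (ennreal (2 * r) * ennreal (riesz_const * (indicator {?R..} (nrm x) / nrm x ^ (n + 1))) +
          ennreal (2 * (n + 1) * r) * ennreal (?k {?R..} (n + 2) x))"
      by (rule order_trans[OF ennreal_leI[OF pt[of x]] eq_refl[OF ennreal_four_terms]])
         (use r in \<open>auto simp: less_imp_le\<close>)
  qed
  also have "\<dots> = ((\<integral>\<^sup>+x. ennreal (?k ?A1 (n + 1) (\<lambda>l. x l - y l)) \<partial>M) + (\<integral>\<^sup>+x. ennreal (?k ?A2 (n + 1) x) \<partial>M)) +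
      (ennreal (2 * r) * (\<integral>\<^sup>+x. ennreal (riesz_const * (indicator {?R..} (nrm x) / nrm x ^ (n + 1))) \<partial>M) +
       ennreal (2 * (n + 1) * r) * (\<integral>\<^sup>+x. ennreal (?k {?R..} (n + 2) x) \<partial>M))"
    using i by (simp add: nn_integral_add nn_integral_cmult del: ennreal_plus)
  also have "\<dots> \<le> (ennreal (3 / 2 * ln ((4 * n + 1) * r / (r / n))) + ennreal (3 / 2 * ln (?R / r))) +
      (ennreal (2 * r) * ennreal (sqrt n / ?R) + ennreal (2 * (n + 1) * r) * ennreal (3 / 2 * (1 / ?R)))"
    unfolding sh
    by (intro add_mono mult_left_mono nn_integral_annulus_le nn_integral_tail_le nn_integral_coord_tail_le i nr r) auto
  also have "\<dots> = ennreal (3 / 2 * ln ((4 * n + 1) * n) + 3 / 2 * ln (4 * n) + 2 * r * (sqrt n / ?R) + 2 * (n + 1) * r * (3 / 2 * (1 / ?R)))"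
  proof -
    have eqs: "(4 * n + 1) * r / (r / n) = (4 * n + 1) * n" "?R / r = 4 * n"
      using r by (auto simp: field_simps)
    have "1 \<le> real ((4 * n + 1) * n)" "1 \<le> real (4 * n)"
      using n2 by (simp_all only: one_of_nat_le_iff) (simp_all add: Suc_le_eq)
    then have "0 \<le> 3 / 2 * ln (real ((4 * n + 1) * n))" "0 \<le> 3 / 2 * ln (real (4 * n))"
      by (auto intro!: ln_ge_zero mult_nonneg_nonneg simp del: of_nat_mult)
    moreover have "0 \<le> 2 * r" "0 \<le> sqrt n / ?R" "0 \<le> 2 * (n + 1) * r" "0 \<le> 3 / 2 * (1 / ?R)"
      using r by auto
    ultimately show ?thesis
      unfolding eqs add.assoc[of _ "2 * r * (sqrt n / ?R)"] by (intro ennreal_four_terms[symmetric]) auto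
  qed
  also have "\<dots> \<le> ennreal (15 * ln n)"
  proof (rule ennreal_leI)
    \<comment> \<open>The two tail terms equal 1 / (2 sqrt n) and 3 (n + 1) / (4 n).\<close>
    have "sqrt n \<le> n" using n by (simp add: real_le_lsqrt power2_eq_square)
    then have "2 * r * (sqrt n / ?R) \<le> 1 / 2" using r n by (simp add: field_simps)
    moreover have "2 * (n + 1) * r * (3 / 2 * (1 / ?R)) \<le> 9 / 8" using r n by (simp add: field_simps)
    ultimately show "3 / 2 * ln ((4 * n + 1) * n) + 3 / 2 * ln (4 * n) + 2 * r * (sqrt n / ?R) + 2 * (n + 1) * r * (3 / 2 * (1 / ?R)) \<le> 15 * ln n"
      using far_constants by linarith
  qed
  finally show ?thesis .
qed

end

section \<open>The dimension-free \<open>L\<^sup>2\<close> bound\<close>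

text \<open>Gives access to change of variables for absolutely integrable functions. The value
  \<open>\<infinity>\<close> in the other case allows two such integrals to be compared before
  either is known to be finite.\<close>

lemma nn_integral_eq_absolute_integral:
  fixes h :: "real \<Rightarrow> real"
  assumes [measurable]: "h \<in> borel_measurable borel" and h: "\<And>x. 0 \<le> h x" and S: "S \<in> sets borel"
  shows "(\<integral>\<^sup>+x. ennreal (h x) * indicator S x \<partial>lborel) =
    (if h absolutely_integrable_on S then ennreal (integral S h) else \<infinity>)"
proof -
  have eq: "(\<integral>\<^sup>+x. ennreal (h x) * indicator S x \<partial>lborel) = (\<integral>\<^sup>+x. ennreal (indicator S x *\<^sub>R h x) \<partial>lebesgue)"
    unfolding nn_integral_completion by (intro nn_integral_cong) (auto simp: indicator_def)
  have [measurable]: "S \<in> sets lebesgue" "h \<in> borel_measurable lebesgue"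
    using S assms(1) by (auto intro: measurable_completion simp: measurable_lborel1)
  show ?thesis
  proof (cases "h absolutely_integrable_on S")
    case True
    then have int: "integrable lebesgue (\<lambda>x. indicator S x *\<^sub>R h x)"
      by (simp add: set_integrable_def)
    have "(\<integral>\<^sup>+x. ennreal (indicator S x *\<^sub>R h x) \<partial>lebesgue) = ennreal (\<integral>x. indicator S x *\<^sub>R h x \<partial>lebesgue)"
      using int by (rule nn_integral_eq_integral) (auto simp: h)
    also have "(\<integral>x. indicator S x *\<^sub>R h x \<partial>lebesgue) = integral S h"
      using set_lebesgue_integral_eq_integral(2)[OF True] by (simp add: set_lebesgue_integral_def)
    finally show ?thesis using True eq by simp
  next
    case False
    have "\<not> (\<integral>\<^sup>+x. ennreal (indicator S x *\<^sub>R h x) \<partial>lebesgue) < \<infinity>"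
    proof
      assume "(\<integral>\<^sup>+x. ennreal (indicator S x *\<^sub>R h x) \<partial>lebesgue) < \<infinity>"
      then have "integrable lebesgue (\<lambda>x. indicator S x *\<^sub>R h x)"
        by (intro integrableI_nonneg) (auto simp: h)
      with False show False by (simp add: set_integrable_def)
    qed
    then have "(\<integral>\<^sup>+x. ennreal (indicator S x *\<^sub>R h x) \<partial>lebesgue) = \<infinity>"
      unfolding infinity_ennreal_def using top.not_eq_extremum by blast
    with False eq show ?thesis by simp
  qed
qed

text \<open>The hypothesis says that the measure with density \<open>f\<close> on the half-line changes sign
  under the inversion \<open>\<rho> \<mapsto> \<kappa> / \<rho>\<close>.\<close>

lemma nn_integral_inversion_odd:
  fixes f :: "real \<Rightarrow> real"
  assumes [measurable]: "f \<in> borel_measurable borel" and \<kappa>: "0 < \<kappa>"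
    and odd: "\<And>\<rho>. 0 < \<rho> \<Longrightarrow> f (\<kappa> / \<rho>) * (\<kappa> / \<rho>\<^sup>2) = - f \<rho>"
  shows "(\<integral>\<^sup>+\<rho>. ennreal (f \<rho>) * indicator {0<..} \<rho> \<partial>lborel) =
    (\<integral>\<^sup>+\<rho>. ennreal (- f \<rho>) * indicator {0<..} \<rho> \<partial>lborel)"
proof -
  let ?S = "{0<..} :: real set"
  let ?p = "\<lambda>\<rho>. max 0 (f \<rho>)" and ?m = "\<lambda>\<rho>. max 0 (- f \<rho>)"
  have img: "(\<lambda>\<rho>. \<kappa> / \<rho>) ` ?S = ?S"
  proof -
    have "\<rho> \<in> (\<lambda>\<rho>. \<kappa> / \<rho>) ` ?S" if "0 < \<rho>" for \<rho>
      using that \<kappa> by (intro image_eqI[of _ _ "\<kappa> / \<rho>"]) auto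
    then show ?thesis using \<kappa> by auto
  qed
  have eq: "\<bar>- \<kappa> / \<rho>\<^sup>2\<bar> * ?p (\<kappa> / \<rho>) = ?m \<rho>" if "\<rho> \<in> ?S" for \<rho>
  proof -
    have "\<bar>- \<kappa> / \<rho>\<^sup>2\<bar> * ?p (\<kappa> / \<rho>) = max 0 (\<kappa> / \<rho>\<^sup>2 * f (\<kappa> / \<rho>))"
    proof -
      have "\<bar>- \<kappa> / \<rho>\<^sup>2\<bar> = \<kappa> / \<rho>\<^sup>2" "0 \<le> \<kappa> / \<rho>\<^sup>2" using \<kappa> by auto
      then show ?thesis
        using max_mult_distrib_left[of "\<kappa> / \<rho>\<^sup>2" 0 "f (\<kappa> / \<rho>)"] by (simp only: mult_zero_right if_True)
    qed
    then show ?thesis using odd[of \<rho>] that by (simp add: mult.commute)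
  qed
  \<comment> \<open>The change of variables transfers integrability together with the value, in both
    directions, so the positive part of \<open>f\<close> is matched with its negative part in the
    infinite case as well.\<close>
  have cov: "(\<lambda>\<rho>. \<bar>- \<kappa> / \<rho>\<^sup>2\<bar> * ?p (\<kappa> / \<rho>)) absolutely_integrable_on ?S \<and>
      integral ?S (\<lambda>\<rho>. \<bar>- \<kappa> / \<rho>\<^sup>2\<bar> * ?p (\<kappa> / \<rho>)) = b \<longleftrightarrow>
      ?p absolutely_integrable_on (\<lambda>\<rho>. \<kappa> / \<rho>) ` ?S \<and> integral ((\<lambda>\<rho>. \<kappa> / \<rho>) ` ?S) ?p = b" for b
    using \<kappa>
    by (intro has_absolute_integral_change_of_variables_1')
       (auto intro!: derivative_eq_intros inj_onI simp: power2_eq_square)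
  have "(\<lambda>\<rho>. \<bar>- \<kappa> / \<rho>\<^sup>2\<bar> * ?p (\<kappa> / \<rho>)) absolutely_integrable_on ?S \<longleftrightarrow> ?m absolutely_integrable_on ?S"
    by (rule set_integrable_cong) (use eq in auto)
  moreover have "integral ?S (\<lambda>\<rho>. \<bar>- \<kappa> / \<rho>\<^sup>2\<bar> * ?p (\<kappa> / \<rho>)) = integral ?S ?m"
    by (rule Henstock_Kurzweil_Integration.integral_cong) (use eq in auto)
  ultimately have "?m absolutely_integrable_on ?S \<longleftrightarrow> ?p absolutely_integrable_on ?S"
    "?p absolutely_integrable_on ?S \<Longrightarrow> integral ?S ?p = integral ?S ?m"
    using cov unfolding img by blast+
  then have "(\<integral>\<^sup>+\<rho>. ennreal (?p \<rho>) * indicator ?S \<rho> \<partial>lborel) = (\<integral>\<^sup>+\<rho>. ennreal (?m \<rho>) * indicator ?S \<rho> \<partial>lborel)"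
    by (simp add: nn_integral_eq_absolute_integral)
  then show ?thesis by (simp add: ennreal_max_0)
qed

context euclid_dim
begin

section \<open>Vanishing of the quadratic kernel integrals\<close>

lemma reg_sq: "(reg e z)\<^sup>2 = (nrm z)\<^sup>2 + e\<^sup>2"
  by (simp add: reg_def)

lemma reg_nonneg [simp]: "0 \<le> reg e z"
  by (simp add: reg_def)

lemma reg_aff_sq:
  "(reg e (\<lambda>i. aff \<rho> (\<lambda>_. 0) x i + s * h i))\<^sup>2 = \<rho>\<^sup>2 * (nrm x)\<^sup>2 + 2 * s * \<rho> * (\<Sum>i<n. x i * h i) + s\<^sup>2 * (nrm h)\<^sup>2 + e\<^sup>2"
  by (simp add: reg_sq nrm_sq power2_sum power_mult_distrib sum.distrib sum_distrib_left algebra_simps)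

text \<open>The denominator is built from the distances of (x, 0) to the poles (h, e) and (-h, e) in
  dimension n + 1. Both poles have the same length, so inversion in the sphere about the origin
  through them fixes them and scales both squared distances by one common factor; the numerator is
  scaled by minus that factor. Positive and negative parts are compared as extended values, so the
  balance can be obtained ray by ray.\<close>

lemma conjugate_kernel_balance:
  fixes h :: "nat \<Rightarrow> real" and e :: real
  assumes e: "0 < e"
  defines "g \<equiv> \<lambda>x. ((nrm x)\<^sup>2 - (nrm h)\<^sup>2 - e\<^sup>2) / (reg e (\<lambda>i. x i - h i) * reg e (\<lambda>i. x i + h i)) ^ (n + 1)"
  shows "(\<integral>\<^sup>+x. ennreal (g x) \<partial>M) = (\<integral>\<^sup>+x. ennreal (- g x) \<partial>M)"
proof -
  have g_meas [measurable]: "g \<in> borel_measurable M"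
    unfolding g_def by measurable
  define T where "T = (nrm h)\<^sup>2 + e\<^sup>2"
  have T: "0 < T" using e by (simp add: T_def add_nonneg_pos)
  let ?sc = "\<lambda>\<rho> x. aff \<rho> (\<lambda>_. 0) x"
  have inner: "(\<integral>\<^sup>+\<rho>. ennreal (\<rho> ^ (n - 1) * g (?sc \<rho> x)) * indicator {0<..} \<rho> \<partial>lborel) =
      (\<integral>\<^sup>+\<rho>. ennreal (- (\<rho> ^ (n - 1) * g (?sc \<rho> x))) * indicator {0<..} \<rho> \<partial>lborel)" if x: "nrm x \<noteq> 0" for x
  proof (rule nn_integral_inversion_odd)
    define X where "X = (nrm x)\<^sup>2"
    have X: "0 < X" using x by (simp add: X_def)
    show "(\<lambda>\<rho>. \<rho> ^ (n - 1) * g (?sc \<rho> x)) \<in> borel_measurable borel"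
    proof -
      have "(\<lambda>\<rho>. ?sc \<rho> x) \<in> measurable borel M"
        by (rule measurable_aff) auto
      from measurable_compose[OF this g_meas] show ?thesis by (intro borel_measurable_times) auto
    qed
    show "0 < T / X" using T X by simp
    fix \<rho> :: real assume \<rho>: "0 < \<rho>"
    \<comment> \<open>The inversion sends rho to m rho. Everything rests on
      \<open>m * \<rho>\<^sup>2 * X = T\<close>: it makes both squared distances scale by m and the
      numerator by -m.\<close>
    define m where "m = T / X / \<rho>\<^sup>2"
    have m: "0 < m" using T X \<rho> by (simp add: m_def)
    define B where "B = (\<lambda>\<rho>. reg e (\<lambda>i. ?sc \<rho> x i - h i) * reg e (\<lambda>i. ?sc \<rho> x i + h i))"
    have scale: "T / X / \<rho> = m * \<rho>" using \<rho> by (simp add: m_def power2_eq_square)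
    have m\<rho>: "m * \<rho>\<^sup>2 * X = T" using \<rho> X by (simp add: m_def)
    have reg_scale: "reg e (\<lambda>i. ?sc (m * \<rho>) x i + s * h i) = sqrt m * reg e (\<lambda>i. ?sc \<rho> x i + s * h i)" if "s\<^sup>2 = 1" for s
    proof -
      have "(reg e (\<lambda>i. ?sc (m * \<rho>) x i + s * h i))\<^sup>2 = m * (m * \<rho>\<^sup>2 * X) + m * (2 * s * \<rho> * (\<Sum>i<n. x i * h i)) + T"
        unfolding reg_aff_sq using that by (simp add: T_def X_def power2_eq_square algebra_simps)
      also have "\<dots> = m * (reg e (\<lambda>i. ?sc \<rho> x i + s * h i))\<^sup>2"
        unfolding reg_aff_sq using that m\<rho> by (simp add: T_def X_def algebra_simps)
      also have "\<dots> = (sqrt m * reg e (\<lambda>i. ?sc \<rho> x i + s * h i))\<^sup>2"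
        using m by (simp add: power_mult_distrib)
      finally show ?thesis
        using m by (subst (asm) power2_eq_iff_nonneg) auto
    qed
    have B_scale: "B (m * \<rho>) = m * B \<rho>"
    proof -
      have "B (m * \<rho>) = (sqrt m * sqrt m) * B \<rho>"
        using reg_scale[of 1] reg_scale[of "-1"] unfolding B_def by simp
      then show ?thesis using m by simp
    qed
    have g_eq: "g (?sc t x) = ((nrm (?sc t x))\<^sup>2 - (nrm h)\<^sup>2 - e\<^sup>2) / B t ^ (n + 1)" for t
      by (simp add: g_def B_def)
    have num: "(nrm (?sc (m * \<rho>) x))\<^sup>2 - (nrm h)\<^sup>2 - e\<^sup>2 = - m * ((nrm (?sc \<rho> x))\<^sup>2 - (nrm h)\<^sup>2 - e\<^sup>2)"
    proof -
      have "(nrm (?sc (m * \<rho>) x))\<^sup>2 = m * (m * \<rho>\<^sup>2 * X)" "(nrm (?sc \<rho> x))\<^sup>2 = \<rho>\<^sup>2 * X"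
        by (simp_all add: X_def power_mult_distrib power2_eq_square)
      moreover have "m * (m * \<rho>\<^sup>2 * X) - T = - m * (\<rho>\<^sup>2 * X - T)"
        using m\<rho> by (simp add: algebra_simps)
      ultimately have "(nrm (?sc (m * \<rho>) x))\<^sup>2 - T = - m * ((nrm (?sc \<rho> x))\<^sup>2 - T)"
        by (simp only:)
      then show ?thesis by (simp add: T_def algebra_simps)
    qed
    have pw: "n + 1 = (n - 1) + 2" using n_pos(1) by linarith
    have "(T / X / \<rho>) ^ (n - 1) * g (?sc (T / X / \<rho>) x) * (T / X / \<rho>\<^sup>2) =
        (m * \<rho>) ^ (n - 1) * (- m * ((nrm (?sc \<rho> x))\<^sup>2 - (nrm h)\<^sup>2 - e\<^sup>2) / (m * B \<rho>) ^ (n + 1)) * m"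
      unfolding scale m_def[symmetric] g_eq num B_scale ..
    also have "\<dots> = - (\<rho> ^ (n - 1) * (((nrm (?sc \<rho> x))\<^sup>2 - (nrm h)\<^sup>2 - e\<^sup>2) / B \<rho> ^ (n + 1)))"
    proof -
      \<comment> \<open>Powers of m: n - 1 from the polar weight, one from the numerator and one
        from the Jacobian, against n + 1 from the denominator.\<close>
      have "m ^ (n + 1) = m ^ (n - 1) * m * m" unfolding pw power_add by (simp add: power2_eq_square)
      then show ?thesis using m by (simp add: power_mult_distrib)
    qed
    finally show "(T / X / \<rho>) ^ (n - 1) * g (?sc (T / X / \<rho>) x) * (T / X / \<rho>\<^sup>2) = - (\<rho> ^ (n - 1) * g (?sc \<rho> x))"
      unfolding g_eq .
  qed
  \<comment> \<open>This is the polar weight for p = 1. Any exponent serves here, because the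
    balance already holds on every ray.\<close>
  let ?c = "\<lambda>x. ennreal (indicator {..1} (nrm x) * nrm x)"
  have polar: "(\<integral>\<^sup>+x. ennreal (f x) \<partial>M) =
      (\<integral>\<^sup>+x. ?c x * (\<integral>\<^sup>+\<rho>. ennreal (\<rho> ^ (n - 1) * f (?sc \<rho> x)) * indicator {0<..} \<rho> \<partial>lborel) \<partial>M)"
    if [measurable]: "f \<in> borel_measurable M" for f
  proof -
    have "(\<integral>\<^sup>+x. ennreal (f x) \<partial>M) = (\<integral>\<^sup>+x. \<integral>\<^sup>+\<rho>. ennreal (indicator {..1} (nrm x) * real 1 * nrm x ^ 1 * (indicator {0<..} \<rho> * \<rho> ^ (n - 1)))
        * ennreal (f (?sc \<rho> x)) \<partial>lborel \<partial>M)"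
      by (rule nn_integral_polar) auto
    also have "\<dots> = (\<integral>\<^sup>+x. \<integral>\<^sup>+\<rho>. ?c x * (ennreal (\<rho> ^ (n - 1) * f (?sc \<rho> x)) * indicator {0<..} \<rho>) \<partial>lborel \<partial>M)"
      by (intro nn_integral_cong) (auto simp: indicator_def ennreal_mult' mult.assoc split: if_splits)
    also have "\<dots> = (\<integral>\<^sup>+x. ?c x * (\<integral>\<^sup>+\<rho>. ennreal (\<rho> ^ (n - 1) * f (?sc \<rho> x)) * indicator {0<..} \<rho> \<partial>lborel) \<partial>M)"
      by (intro nn_integral_cong nn_integral_cmult) measurable
    finally show ?thesis .
  qed
  have "(\<integral>\<^sup>+x. ?c x * (\<integral>\<^sup>+\<rho>. ennreal (\<rho> ^ (n - 1) * g (?sc \<rho> x)) * indicator {0<..} \<rho> \<partial>lborel) \<partial>M) =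
     (\<integral>\<^sup>+x. ?c x * (\<integral>\<^sup>+\<rho>. ennreal (\<rho> ^ (n - 1) * - g (?sc \<rho> x)) * indicator {0<..} \<rho> \<partial>lborel) \<partial>M)"
    using AE_nrm_neq_0 by (intro nn_integral_cong_AE) (auto elim!: eventually_mono simp: inner simp del: One_nat_def)
  then show ?thesis
    unfolding polar[OF g_meas] using polar[of "\<lambda>x. - g x"] by simp
qed

text \<open>Equal positive and negative parts cancel if the function is integrable; otherwise the
  Bochner integral is zero by convention.\<close>

lemma conjugate_kernel_integral:
  assumes e: "0 < e"
  shows "(\<integral>x. ((nrm x)\<^sup>2 - (nrm h)\<^sup>2 - e\<^sup>2) / (reg e (\<lambda>i. x i - h i) * reg e (\<lambda>i. x i + h i)) ^ (n + 1) \<partial>M) = 0"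
    (is "integral\<^sup>L M ?g = 0")
proof (cases "integrable M ?g")
  case True
  then show ?thesis
    using conjugate_kernel_balance[OF e, of h] by (subst real_lebesgue_integral_def) auto
qed (simp add: not_integrable_integral_eq)

lemma abs_riesz_kernel_bound:
  assumes e: "0 < e" and i: "i < n"
  shows "\<bar>riesz_kernel e i z\<bar> \<le> riesz_const / e ^ n"
proof -
  have "\<bar>riesz_kernel e i z\<bar> = riesz_const * (\<bar>z i\<bar> * (1 / reg e z ^ (n + 1)))"
    using reg_pos[OF e, of z] by (simp add: riesz_kernel_def abs_mult less_imp_le)
  also have "\<dots> \<le> riesz_const * (reg e z * (1 / reg e z ^ (n + 1)))"
    using abs_coord_le_nrm[OF i, of z] nrm_le_reg[of z e] reg_pos[OF e, of z]
    by (intro mult_left_mono mult_right_mono) (auto simp: less_imp_le)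
  also have "\<dots> = riesz_const / reg e z ^ n"
    using reg_pos[OF e, of z] by simp
  also have "\<dots> \<le> riesz_const / e ^ n"
    using le_reg[OF e, of z] reg_pos[OF e, of z] e
    by (intro divide_left_mono power_mono) (auto simp: less_imp_le)
  finally show ?thesis .
qed

lemma poisson_kernel_nonneg: "0 < e \<Longrightarrow> 0 \<le> poisson_kernel e z"
  by (simp add: poisson_kernel_def less_imp_le)

lemma poisson_kernel_bound:
  assumes e: "0 < e"
  shows "poisson_kernel e z \<le> riesz_const / e ^ n"
proof -
  have "poisson_kernel e z \<le> riesz_const * e / e ^ (n + 1)"
    unfolding poisson_kernel_def using le_reg[OF e, of z] reg_pos[OF e, of z] e
    by (intro divide_left_mono power_mono) (auto simp: less_imp_le)
  then show ?thesis using e by simp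
qed

text \<open>The polarised form of "Riesz squares minus Poisson square". With z = x - y and w = x -
  y', integrating over y and y' in a set gives the difference of the squares of the corresponding
  potentials at x.\<close>

definition pair_kernel :: "real \<Rightarrow> (nat \<Rightarrow> real) \<Rightarrow> (nat \<Rightarrow> real) \<Rightarrow> real" where
  "pair_kernel e z w = (\<Sum>i<n. riesz_kernel e i z * riesz_kernel e i w) - poisson_kernel e z * poisson_kernel e w"

lemma pair_kernel_eq:
  "pair_kernel e z w = riesz_const\<^sup>2 * (((\<Sum>i<n. z i * w i) - e\<^sup>2) / (reg e z * reg e w) ^ (n + 1))"
proof -
  let ?q = "1 / (reg e z * reg e w) ^ (n + 1)"
  have "riesz_kernel e i z * riesz_kernel e i w = riesz_const\<^sup>2 * ?q * (z i * w i)" for i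
    unfolding riesz_kernel_def power_mult_distrib times_divide_times_eq power2_eq_square by (simp add: mult_ac)
  moreover have "poisson_kernel e z * poisson_kernel e w = riesz_const\<^sup>2 * ?q * e\<^sup>2"
    unfolding poisson_kernel_def power_mult_distrib times_divide_times_eq power2_eq_square by (simp add: mult_ac)
  ultimately have "pair_kernel e z w = riesz_const\<^sup>2 * ?q * ((\<Sum>i<n. z i * w i) - e\<^sup>2)"
    by (simp add: pair_kernel_def sum_distrib_left right_diff_distrib)
  then show ?thesis by simp
qed

lemma pair_kernel_cong:
  "(\<And>i. i < n \<Longrightarrow> z i = z' i) \<Longrightarrow> (\<And>i. i < n \<Longrightarrow> w i = w' i) \<Longrightarrow> pair_kernel e z w = pair_kernel e z' w'"
  unfolding pair_kernel_eq using reg_cong[of z z' e] reg_cong[of w w' e] by simp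

lemma measurable_pair_kernel [measurable (raw)]:
  assumes "\<And>i. i < n \<Longrightarrow> (\<lambda>v. f v i) \<in> borel_measurable N" "\<And>i. i < n \<Longrightarrow> (\<lambda>v. g v i) \<in> borel_measurable N"
  shows "(\<lambda>v. pair_kernel e (f v) (g v)) \<in> borel_measurable N"
proof -
  have [measurable]: "(\<lambda>v. reg e (f v)) \<in> borel_measurable N" "(\<lambda>v. reg e (g v)) \<in> borel_measurable N"
    using assms by measurable
  have [measurable]: "(\<lambda>v. \<Sum>i<n. f v i * g v i) \<in> borel_measurable N"
    using assms by (intro borel_measurable_sum borel_measurable_times) auto
  show ?thesis unfolding pair_kernel_eq by measurable
qed

text \<open>Moving the origin to the midpoint of y and y' turns the two arguments into x - h and x +
  h, whose inner product is |x|^2 - |h|^2.\<close>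

lemma integral_pair_kernel:
  assumes e: "0 < e"
  shows "(\<integral>x. pair_kernel e (\<lambda>i. x i - y i) (\<lambda>i. x i - y' i) \<partial>M) = 0"
proof -
  define b h where "b = (\<lambda>i. (y i + y' i) / 2)" and "h = (\<lambda>i. (y i - y' i) / 2)"
  have bh: "b i - y i = - h i" "b i - y' i = h i" for i
    by (simp_all add: b_def h_def field_simps)
  have "(\<integral>x. pair_kernel e (\<lambda>i. x i - y i) (\<lambda>i. x i - y' i) \<partial>M) =
      (\<integral>x. pair_kernel e (\<lambda>i. aff 1 b x i - y i) (\<lambda>i. aff 1 b x i - y' i) \<partial>M)"
    by (rule integral_shift[symmetric]) measurable
  also have "\<dots> = (\<integral>x. riesz_const\<^sup>2 * (((nrm x)\<^sup>2 - (nrm h)\<^sup>2 - e\<^sup>2) / (reg e (\<lambda>i. x i - h i) * reg e (\<lambda>i. x i + h i)) ^ (n + 1)) \<partial>M)"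
  proof (rule Bochner_Integration.integral_cong[OF refl])
    fix x
    have "pair_kernel e (\<lambda>i. aff 1 b x i - y i) (\<lambda>i. aff 1 b x i - y' i) = pair_kernel e (\<lambda>i. x i - h i) (\<lambda>i. x i + h i)"
      using bh by (intro pair_kernel_cong) (auto simp: algebra_simps)
    moreover have "(\<Sum>i<n. (x i - h i) * (x i + h i)) = (nrm x)\<^sup>2 - (nrm h)\<^sup>2"
      unfolding nrm_sq sum_subtractf[symmetric] by (intro sum.cong) (auto simp: power2_eq_square algebra_simps)
    ultimately show "pair_kernel e (\<lambda>i. aff 1 b x i - y i) (\<lambda>i. aff 1 b x i - y' i) =
        riesz_const\<^sup>2 * (((nrm x)\<^sup>2 - (nrm h)\<^sup>2 - e\<^sup>2) / (reg e (\<lambda>i. x i - h i) * reg e (\<lambda>i. x i + h i)) ^ (n + 1))"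
      by (simp add: pair_kernel_eq)
  qed
  also have "\<dots> = 0"
    by (simp only: integral_mult_right_zero conjugate_kernel_integral[OF e] mult_zero_right)
  finally show ?thesis .
qed

text \<open>A crude bound that degenerates as e tends to 0; its purpose is to justify exchanging
  integrals. Each square in the numerator is absorbed by the power of the same length below it, and
  the n - 1 powers left over are bounded through e.\<close>

lemma abs_pair_kernel_le:
  assumes e: "0 < e"
  shows "\<bar>pair_kernel e z w\<bar> \<le> riesz_const\<^sup>2 / e ^ (n - 1) * (1 / reg e z ^ (n + 1) + 1 / reg e w ^ (n + 1))"
proof -
  let ?a = "reg e z" and ?b = "reg e w"
  have a: "0 < ?a" "e \<le> ?a" and b: "0 < ?b" "e \<le> ?b"
    using reg_pos[OF e] le_reg[OF e] by auto
  have "\<bar>(\<Sum>i<n. z i * w i) - e\<^sup>2\<bar> \<le> (\<Sum>i<n. \<bar>z i * w i\<bar>) + e\<^sup>2"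
    using sum_abs[of "\<lambda>i. z i * w i" "{..<n}"] by (intro order_trans[OF abs_triangle_ineq4] add_mono) auto
  also have "(\<Sum>i<n. \<bar>z i * w i\<bar>) \<le> (\<Sum>i<n. ((z i)\<^sup>2 + (w i)\<^sup>2) / 2)"
  proof (rule sum_mono)
    fix i show "\<bar>z i * w i\<bar> \<le> ((z i)\<^sup>2 + (w i)\<^sup>2) / 2"
      using sum_squares_bound[of "\<bar>z i\<bar>" "\<bar>w i\<bar>"] by (simp add: abs_mult)
  qed
  also have "\<dots> + e\<^sup>2 = (?a\<^sup>2 + ?b\<^sup>2) / 2"
    by (simp add: reg_sq nrm_sq sum.distrib add_divide_distrib flip: sum_divide_distrib)
  also have "\<dots> \<le> ?a\<^sup>2 + ?b\<^sup>2" by simp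
  finally have num: "\<bar>(\<Sum>i<n. z i * w i) - e\<^sup>2\<bar> \<le> ?a\<^sup>2 + ?b\<^sup>2" by simp
  have pw: "n + 1 = (n - 1) + 2" using n_pos(1) by linarith
  have split: "t\<^sup>2 / (t * u) ^ (n + 1) \<le> 1 / e ^ (n - 1) * (1 / u ^ (n + 1))" if "e \<le> t" "0 < u" for t u
  proof -
    have t: "0 < t" using that e by linarith
    have "t\<^sup>2 / (t * u) ^ (n + 1) = (1 / t ^ (n - 1)) * (1 / u ^ (n + 1))"
    proof -
      have "t ^ (n + 1) = t ^ (n - 1) * t\<^sup>2" unfolding pw power_add ..
      then show ?thesis using t by (simp only: power_mult_distrib) simp
    qed
    also have "\<dots> \<le> 1 / e ^ (n - 1) * (1 / u ^ (n + 1))"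
      using that t e by (intro mult_right_mono divide_left_mono power_mono) auto
    finally show ?thesis .
  qed
  have "\<bar>pair_kernel e z w\<bar> = riesz_const\<^sup>2 * (\<bar>(\<Sum>i<n. z i * w i) - e\<^sup>2\<bar> / (?a * ?b) ^ (n + 1))"
    using a b by (simp add: pair_kernel_eq abs_mult abs_divide)
  also have "\<dots> \<le> riesz_const\<^sup>2 * ((?a\<^sup>2 + ?b\<^sup>2) / (?a * ?b) ^ (n + 1))"
    using a b num by (intro mult_left_mono divide_right_mono) auto
  also have "\<dots> \<le> riesz_const\<^sup>2 * (1 / e ^ (n - 1) * (1 / ?b ^ (n + 1)) + 1 / e ^ (n - 1) * (1 / ?a ^ (n + 1)))"
    unfolding add_divide_distrib
    using split[OF a(2) b(1)] split[OF b(2) a(1)] by (intro mult_left_mono add_mono) (auto simp: mult.commute[of ?b])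
  also have "\<dots> = riesz_const\<^sup>2 / e ^ (n - 1) * (1 / ?a ^ (n + 1) + 1 / ?b ^ (n + 1))"
    by (simp add: algebra_simps)
  finally show ?thesis .
qed

lemma nn_integral_shift_sub:
  assumes [measurable]: "f \<in> borel_measurable M"
    and cong: "\<And>x y. (\<And>i. i < n \<Longrightarrow> x i = y i) \<Longrightarrow> f x = f y"
  shows "(\<integral>\<^sup>+x. f (\<lambda>i. x i - y i) \<partial>M) = (\<integral>\<^sup>+x. f x \<partial>M)"
proof -
  have "(\<integral>\<^sup>+x. f (\<lambda>i. x i - y i) \<partial>M) = (\<integral>\<^sup>+x. f (aff 1 (\<lambda>i. - y i) x) \<partial>M)"
    by (intro nn_integral_cong cong) simp
  then show ?thesis by (simp add: nn_integral_shift)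
qed

lemma nn_integral_reg_shift_le:
  assumes e: "0 < e"
  shows "(\<integral>\<^sup>+x. ennreal (1 / reg e (\<lambda>i. x i - y i) ^ (n + 1)) \<partial>M) \<le> ennreal (pi / (riesz_const * e))"
proof -
  have "(\<integral>\<^sup>+x. ennreal (1 / reg e (\<lambda>i. x i - y i) ^ (n + 1)) \<partial>M) = (\<integral>\<^sup>+x. ennreal (1 / reg e x ^ (n + 1)) \<partial>M)"
  proof (rule nn_integral_shift_sub[of "\<lambda>x. ennreal (1 / reg e x ^ (n + 1))"])
    show "ennreal (1 / reg e x ^ (n + 1)) = ennreal (1 / reg e z ^ (n + 1))" if "\<And>i. i < n \<Longrightarrow> x i = z i" for x z
      by (subst reg_cong[of x z]) (use that in auto)
  qed measurable
  with nn_integral_reg_le[OF e] show ?thesis by simp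
qed

text \<open>The first form integrates out the point of evaluation and bounds the integral of a
  Poisson potential; the second integrates out the source and bounds the potential
  pointwise.\<close>

lemma nn_integral_poisson_le:
  assumes e: "0 < e"
  shows "(\<integral>\<^sup>+x. ennreal (poisson_kernel e (\<lambda>i. x i - y i)) \<partial>M) \<le> ennreal pi"
    and "(\<integral>\<^sup>+x. ennreal (poisson_kernel e (\<lambda>i. y i - x i)) \<partial>M) \<le> ennreal pi"
proof -
  have "(\<integral>\<^sup>+x. ennreal (poisson_kernel e (\<lambda>i. x i - y i)) \<partial>M) =
      ennreal (riesz_const * e) * (\<integral>\<^sup>+x. ennreal (1 / reg e (\<lambda>i. x i - y i) ^ (n + 1)) \<partial>M)"
    using e by (subst nn_integral_cmult[symmetric])
      (auto intro!: nn_integral_cong simp: poisson_kernel_def less_imp_le simp flip: ennreal_mult)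
  also have "\<dots> \<le> ennreal (riesz_const * e) * ennreal (pi / (riesz_const * e))"
    by (intro mult_left_mono nn_integral_reg_shift_le e) auto
  also have "\<dots> = ennreal pi"
    using e less_imp_neq[OF riesz_const_pos] by (subst ennreal_mult[symmetric]) (auto simp: less_imp_le)
  finally show 1: "(\<integral>\<^sup>+x. ennreal (poisson_kernel e (\<lambda>i. x i - y i)) \<partial>M) \<le> ennreal pi" .
  have "reg e (\<lambda>i. y i - x i) = reg e (\<lambda>i. x i - y i)" for x
    unfolding reg_def by (subst nrm_minus) simp
  then show "(\<integral>\<^sup>+x. ennreal (poisson_kernel e (\<lambda>i. y i - x i)) \<partial>M) \<le> ennreal pi"
    using 1 unfolding poisson_kernel_def by (simp only:)
qed

text \<open>For e > 0 the kernel is bounded, so on a set of finite measure this is an ordinary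
  integral.\<close>

definition riesz_set :: "real \<Rightarrow> nat \<Rightarrow> (nat \<Rightarrow> real) set \<Rightarrow> (nat \<Rightarrow> real) \<Rightarrow> real" where
  "riesz_set e i E x = (\<integral>y. indicator E y * riesz_kernel e i (\<lambda>l. x l - y l) \<partial>M)"

text \<open>The identity leaves the square of the Poisson integral \<open>Q\<close>, which is at
  most pi pointwise and has integral at most pi times the measure of E. Once the identity has been
  used, all squares but the j-th are dropped.\<close>

lemma riesz_L2:
  assumes e: "0 < e" and E [measurable]: "E \<in> sets M" and fin: "emeasure M E < \<infinity>" and j: "j < n"
  shows "(\<integral>\<^sup>+x. ennreal ((riesz_set e j E x)\<^sup>2) \<partial>M) \<le> ennreal (pi\<^sup>2) * emeasure M E"
proof -
  \<comment> \<open>Restricted to E the measure is finite, so bounded kernels are integrable against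
    it, and the square of a potential becomes an integral over the product of two copies.\<close>
  define N where "N = density M (indicator E)"
  have N_sets [measurable_cong]: "sets N = sets M" and N_space: "space N = space M"
    by (simp_all add: N_def)
  have N_fin: "emeasure N (space N) = emeasure M E"
    by (simp add: N_def emeasure_density)
  interpret N: finite_measure N
    using fin N_fin by (intro finite_measureI) auto
  interpret NN: pair_sigma_finite N N ..
  define N2 where "N2 = N \<Otimes>\<^sub>M N"
  have N2_sets [measurable_cong]: "sets N2 = sets (M \<Otimes>\<^sub>M M)"
    unfolding N2_def by (intro sets_pair_measure_cong N_sets)
  interpret N2: finite_measure N2
  proof
    have "emeasure N2 (space N2) = emeasure N (space N) * emeasure N (space N)"
      unfolding N2_def space_pair_measure by (intro N.emeasure_pair_measure_Times) auto
    also have "\<dots> < \<infinity>" using fin N_fin by (auto simp: ennreal_mult_less_top)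
    finally show "emeasure N2 (space N2) \<noteq> \<infinity>" by simp
  qed
  interpret MN: pair_sigma_finite M N ..
  interpret MN2: pair_sigma_finite M N2 ..
  let ?K = "\<lambda>i x y. riesz_kernel e i (\<lambda>l. x l - y l)"
  let ?P = "\<lambda>x y. poisson_kernel e (\<lambda>l. x l - y l)"
  let ?H = "\<lambda>x y y'. pair_kernel e (\<lambda>l. x l - y l) (\<lambda>l. x l - y' l)"
  define T where "T = (\<lambda>i x. \<integral>y. ?K i x y \<partial>N)"
  define Q where "Q = (\<lambda>x. \<integral>y. ?P x y \<partial>N)"
  define h where "h = (\<lambda>x. (\<Sum>i<n. (T i x)\<^sup>2) - (Q x)\<^sup>2)"
  have T_eq: "riesz_set e i E x = T i x" if i: "i < n" for i x
  proof -
    have "N = density M (\<lambda>y. ennreal (indicator E y))" by (simp add: N_def ennreal_indicator)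
    then show ?thesis
      unfolding riesz_set_def T_def using i by (simp add: integral_density)
  qed
  have K_int: "integrable N (?K i x)" if "i < n" for i x
    using abs_riesz_kernel_bound[OF e that] that
    by (intro N.integrable_const_bound[of _ "riesz_const / e ^ n"]) auto
  have P_int: "integrable N (?P x)" for x
    using poisson_kernel_bound[OF e] poisson_kernel_nonneg[OF e]
    by (intro N.integrable_const_bound[of _ "riesz_const / e ^ n"]) auto
  have T_meas [measurable]: "T i \<in> borel_measurable M" if "i < n" for i
    unfolding T_def using that by measurable
  have Q_meas [measurable]: "Q \<in> borel_measurable M"
    unfolding Q_def by measurable
  have inner: "(\<integral>y'. ?H x y y' \<partial>N) = (\<Sum>i<n. ?K i x y * T i x) - ?P x y * Q x" for x y
    unfolding pair_kernel_def T_def Q_def using K_int P_int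
    by (subst Bochner_Integration.integral_diff) (auto simp: Bochner_Integration.integral_sum)
  have outer: "(\<integral>y. \<integral>y'. ?H x y y' \<partial>N \<partial>N) = h x" for x
  proof -
    have "(\<integral>y. \<integral>y'. ?H x y y' \<partial>N \<partial>N) = (\<Sum>i<n. T i x * T i x) - Q x * Q x"
    proof -
      have TQ: "(\<integral>y. ?K i x y \<partial>N) = T i x" "(\<integral>y. ?P x y \<partial>N) = Q x" for i
        by (simp_all add: T_def Q_def)
      show ?thesis
        unfolding inner using K_int P_int
        by (subst Bochner_Integration.integral_diff) (auto simp: Bochner_Integration.integral_sum TQ)
    qed
    then show ?thesis by (simp add: h_def power2_eq_square)
  qed
  let ?HH = "\<lambda>x p. ?H x (fst p) (snd p)"
  have HH_meas [measurable]: "(\<lambda>(x, p). ?HH x p) \<in> borel_measurable (M \<Otimes>\<^sub>M N2)"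
    by measurable
  let ?D = "riesz_const\<^sup>2 / e ^ (n - 1)" and ?m = "ennreal (pi / (riesz_const * e))"
  have D: "0 \<le> ?D" using e by simp
  \<comment> \<open>The bound is uniform in y and y', so finiteness of \<open>N2\<close> yields
    joint integrability.\<close>
  have H_x: "(\<integral>\<^sup>+x. ennreal (norm (?H x y y')) \<partial>M) \<le> ennreal ?D * (?m + ?m)" for y y'
  proof -
    have "(\<integral>\<^sup>+x. ennreal (norm (?H x y y')) \<partial>M) \<le>
        (\<integral>\<^sup>+x. ennreal ?D * (ennreal (1 / reg e (\<lambda>l. x l - y l) ^ (n + 1)) + ennreal (1 / reg e (\<lambda>l. x l - y' l) ^ (n + 1))) \<partial>M)"
      using abs_pair_kernel_le[OF e] e
      by (intro nn_integral_mono) (auto simp flip: ennreal_plus ennreal_mult intro!: ennreal_leI)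
    also have "\<dots> = ennreal ?D * ((\<integral>\<^sup>+x. ennreal (1 / reg e (\<lambda>l. x l - y l) ^ (n + 1)) \<partial>M) + (\<integral>\<^sup>+x. ennreal (1 / reg e (\<lambda>l. x l - y' l) ^ (n + 1)) \<partial>M))"
      by (simp add: nn_integral_cmult nn_integral_add)
    also have "\<dots> \<le> ennreal ?D * (?m + ?m)"
      by (intro mult_left_mono add_mono nn_integral_reg_shift_le e) auto
    finally show ?thesis .
  qed
  have HH_int: "integrable (M \<Otimes>\<^sub>M N2) (\<lambda>(x, p). ?HH x p)"
  proof (rule integrableI_bounded)
    have "(\<integral>\<^sup>+w. ennreal (norm (case w of (x, p) \<Rightarrow> ?HH x p)) \<partial>(M \<Otimes>\<^sub>M N2)) =
        (\<integral>\<^sup>+p. \<integral>\<^sup>+x. ennreal (norm (?HH x p)) \<partial>M \<partial>N2)"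
      by (subst MN2.nn_integral_snd[symmetric]) auto
    also have "\<dots> \<le> (\<integral>\<^sup>+p. ennreal ?D * (?m + ?m) \<partial>N2)"
      by (intro nn_integral_mono H_x)
    also have "\<dots> < \<infinity>"
      by (simp add: ennreal_mult_eq_top_iff ennreal_add_eq_top N2.emeasure_eq_measure less_top[symmetric])
    finally show "(\<integral>\<^sup>+w. ennreal (norm (case w of (x, p) \<Rightarrow> ?HH x p)) \<partial>(M \<Otimes>\<^sub>M N2)) < \<infinity>" .
  qed measurable
  have h_eq: "h x = (\<integral>p. ?HH x p \<partial>N2)" for x
  proof -
    have "integrable N2 (?HH x)"
    proof (rule N2.integrable_const_bound)
      show "AE p in N2. norm (?HH x p) \<le> ?D * (1 / e ^ (n + 1) + 1 / e ^ (n + 1))"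
      proof (rule AE_I2)
        fix p
        have "1 / reg e z ^ (n + 1) \<le> 1 / e ^ (n + 1)" for z
          using le_reg[OF e, of z] e reg_pos[OF e, of z] by (intro divide_left_mono power_mono) auto
        then have "?D * (1 / reg e (\<lambda>l. x l - fst p l) ^ (n + 1) + 1 / reg e (\<lambda>l. x l - snd p l) ^ (n + 1)) \<le>
            ?D * (1 / e ^ (n + 1) + 1 / e ^ (n + 1))"
          by (intro mult_left_mono[OF _ D] add_mono)
        then show "norm (?HH x p) \<le> ?D * (1 / e ^ (n + 1) + 1 / e ^ (n + 1))"
          using abs_pair_kernel_le[OF e, of "\<lambda>l. x l - fst p l" "\<lambda>l. x l - snd p l"] by simp
      qed
    qed measurable
    from NN.integral_fst'[of "?HH x"] this outer[of x] show ?thesis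
      by (simp add: N2_def)
  qed
  \<comment> \<open>Fubini puts the integral over x innermost, where it vanishes for every pair y,
    y'.\<close>
  have h_int: "integrable M h" and h_0: "(\<integral>x. h x \<partial>M) = 0"
  proof -
    show "integrable M h" unfolding h_eq using MN2.integrable_fst'[OF HH_int] by simp
    have "(\<integral>x. h x \<partial>M) = (\<integral>p. \<integral>x. ?HH x p \<partial>M \<partial>N2)"
      unfolding h_eq using MN2.Fubini_integral[OF HH_int] by simp
    then show "(\<integral>x. h x \<partial>M) = 0" by (simp add: integral_pair_kernel[OF e])
  qed
  have Q_nn: "ennreal (Q x) = (\<integral>\<^sup>+y. ennreal (?P x y) \<partial>N)" for x
    unfolding Q_def using P_int poisson_kernel_nonneg[OF e] by (intro nn_integral_eq_integral[symmetric]) auto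
  have Q_nonneg: "0 \<le> Q x" for x
    unfolding Q_def using poisson_kernel_nonneg[OF e] by (intro Bochner_Integration.integral_nonneg) auto
  have Q_le: "Q x \<le> pi" for x
  proof -
    have "ennreal (Q x) \<le> (\<integral>\<^sup>+y. ennreal (?P x y) \<partial>M)"
      unfolding Q_nn N_def by (subst nn_integral_density) (auto intro!: nn_integral_mono simp: indicator_def)
    also have "\<dots> \<le> ennreal pi" by (rule nn_integral_poisson_le(2)[OF e])
    finally show ?thesis by (simp add: ennreal_le_iff)
  qed
  have "(\<integral>\<^sup>+x. ennreal (Q x) \<partial>M) = (\<integral>\<^sup>+y. \<integral>\<^sup>+x. ennreal (?P x y) \<partial>M \<partial>N)"
    unfolding Q_nn by (intro MN.Fubini'[symmetric]) measurable
  also have "\<dots> \<le> (\<integral>\<^sup>+y. ennreal pi \<partial>N)"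
    by (intro nn_integral_mono nn_integral_poisson_le(1)[OF e])
  also have "\<dots> = ennreal pi * emeasure M E" by (simp add: N_fin)
  finally have Q_int: "(\<integral>\<^sup>+x. ennreal (Q x) \<partial>M) \<le> ennreal pi * emeasure M E" .
  have "(\<integral>\<^sup>+x. ennreal ((Q x)\<^sup>2) \<partial>M) \<le> (\<integral>\<^sup>+x. ennreal pi * ennreal (Q x) \<partial>M)"
    using Q_nonneg Q_le
    by (intro nn_integral_mono) (auto simp: power2_eq_square simp flip: ennreal_mult intro!: ennreal_leI mult_right_mono)
  also have "\<dots> \<le> ennreal pi * (ennreal pi * emeasure M E)"
    by (simp add: nn_integral_cmult Q_int mult_left_mono)
  also have "\<dots> = ennreal (pi\<^sup>2) * emeasure M E"
    by (simp add: power2_eq_square ennreal_mult mult.assoc)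
  finally have Q2: "(\<integral>\<^sup>+x. ennreal ((Q x)\<^sup>2) \<partial>M) \<le> ennreal (pi\<^sup>2) * emeasure M E" .
  \<comment> \<open>Since \<open>h\<close> may be negative, splitting the integral of its sum with
    the square of \<open>Q\<close> needs both to be integrable.\<close>
  have Q2_int: "integrable M (\<lambda>x. (Q x)\<^sup>2)"
    using Q2 fin by (intro integrableI_nonneg) (auto simp: ennreal_mult_less_top intro: order_le_less_trans)
  have "(\<integral>\<^sup>+x. ennreal ((riesz_set e j E x)\<^sup>2) \<partial>M) \<le> (\<integral>\<^sup>+x. ennreal (h x + (Q x)\<^sup>2) \<partial>M)"
  proof (intro nn_integral_mono ennreal_leI)
    fix x
    have "(T j x)\<^sup>2 \<le> (\<Sum>i<n. (T i x)\<^sup>2)" using j by (intro member_le_sum) auto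
    then show "(riesz_set e j E x)\<^sup>2 \<le> h x + (Q x)\<^sup>2" by (simp add: h_def T_eq[OF j])
  qed
  also have "\<dots> = ennreal (\<integral>x. h x + (Q x)\<^sup>2 \<partial>M)"
    by (intro nn_integral_eq_integral AE_I2 Bochner_Integration.integrable_add h_int Q2_int) (simp add: h_def sum_nonneg)
  also have "(\<integral>x. h x + (Q x)\<^sup>2 \<partial>M) = (\<integral>x. (Q x)\<^sup>2 \<partial>M)"
    using h_int Q2_int h_0 by simp
  also have "ennreal (\<integral>x. (Q x)\<^sup>2 \<partial>M) = (\<integral>\<^sup>+x. ennreal ((Q x)\<^sup>2) \<partial>M)"
    using Q2_int by (intro nn_integral_eq_integral[symmetric]) auto
  also note Q2
  finally show ?thesis .
qed

section \<open>Unions of balls\<close>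

text \<open>Stewart's theorem for the point c + t (y - c) on the line through c and y. It holds
  beyond the segment too, and t >= 1 is the case used.\<close>

lemma nrm_dilation_sq:
  "(nrm (\<lambda>l. aff t (\<lambda>l. (1 - t) * c l) y l - d l))\<^sup>2 =
    (1 - t) * (nrm (\<lambda>l. c l - d l))\<^sup>2 + t * (nrm (\<lambda>l. y l - d l))\<^sup>2 - t * (1 - t) * (nrm (\<lambda>l. y l - c l))\<^sup>2"
proof -
  have alg: "((1 - t) * c' + t * y' - d')\<^sup>2 = (1 - t) * (c' - d')\<^sup>2 + t * (y' - d')\<^sup>2 - t * (1 - t) * (y' - c')\<^sup>2"
    for c' d' y' :: real
  proof -
    define p q where "p = c' - d'" and "q = y' - d'"
    have eqs: "(1 - t) * c' + t * y' - d' = p + t * (q - p)" "y' - c' = q - p"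
      by (simp_all add: p_def q_def left_diff_distrib right_diff_distrib)
    have "(p + t * (q - p))\<^sup>2 = (1 - t) * p\<^sup>2 + t * q\<^sup>2 - t * (1 - t) * (q - p)\<^sup>2"
      by (simp add: power2_eq_square left_diff_distrib right_diff_distrib distrib_left distrib_right mult_ac)
    then show ?thesis unfolding eqs by (simp only: p_def q_def)
  qed
  have "(\<Sum>l<n. (aff t (\<lambda>l. (1 - t) * c l) y l - d l)\<^sup>2) =
      (\<Sum>l<n. (1 - t) * (c l - d l)\<^sup>2 + t * (y l - d l)\<^sup>2 - t * (1 - t) * (y l - c l)\<^sup>2)"
    by (rule sum.cong[OF refl]) (simp only: aff_apply lessThan_iff alg)
  also have "\<dots> = (1 - t) * (\<Sum>l<n. (c l - d l)\<^sup>2) + t * (\<Sum>l<n. (y l - d l)\<^sup>2) - t * (1 - t) * (\<Sum>l<n. (y l - c l)\<^sup>2)"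
    by (simp only: sum_subtractf sum.distrib sum_distrib_left)
  finally show ?thesis by (simp only: nrm_sq)
qed

text \<open>Each point of the dilated union is assigned to the centre minimising the power distance
  \<open>|x - c\<^sub>k|\<^sup>2 - (t r\<^sub>k)\<^sup>2\<close>. Contracting every cell towards its centre by the factor \<open>t\<close> sends it into the
  undilated ball, and the contracted cells are still disjoint.\<close>

lemma emeasure_dilated_balls_le:
  fixes c :: "nat \<Rightarrow> nat \<Rightarrow> real" and r :: "nat \<Rightarrow> real"
  assumes t: "1 \<le> t" and r: "\<And>k. k < N \<Longrightarrow> 0 \<le> r k"
  shows "emeasure M (\<Union>k<N. cball_n (c k) (t * r k)) \<le> ennreal (t ^ n) * emeasure M (\<Union>k<N. cball_n (c k) (r k))"
proof -
  define pw where "pw = (\<lambda>k x. (nrm (\<lambda>l. x l - c k l))\<^sup>2 - (t * r k)\<^sup>2)"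
  \<comment> \<open>Ties go to the least index. The strict inequality is what keeps the contracted
    cells disjoint when two centres coincide or t = 1.\<close>
  define A where "A = (\<lambda>k. cball_n (c k) (t * r k) \<inter> {x \<in> space M. \<forall>i\<in>{..<N}. pw k x \<le> pw i x} \<inter>
    {x \<in> space M. \<forall>i\<in>{..<k}. pw k x < pw i x})"
  define B where "B = (\<lambda>k. {y \<in> space M. aff t (\<lambda>l. (1 - t) * c k l) y \<in> A k})"
  have pw_meas [measurable]: "pw k \<in> borel_measurable M" for k
    unfolding pw_def by measurable
  have A_meas [measurable]: "A k \<in> sets M" for k
  proof -
    have 2: "{x \<in> space M. pw k x \<le> pw i x} \<in> sets M" for i
      by (rule borel_measurable_le[OF pw_meas pw_meas])
    have 3: "{x \<in> space M. pw k x < pw i x} \<in> sets M" for i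
      by (rule borel_measurable_less[OF pw_meas pw_meas])
    have 4: "{x \<in> space M. \<forall>i\<in>{..<N}. pw k x \<le> pw i x} \<in> sets M"
      by (rule sets.sets_Collect_finite_All[OF 2 finite_lessThan])
    have 5: "{x \<in> space M. \<forall>i\<in>{..<k}. pw k x < pw i x} \<in> sets M"
      by (rule sets.sets_Collect_finite_All[OF 3 finite_lessThan])
    show ?thesis unfolding A_def by (intro sets.Int sets_cball_n 4 5)
  qed
  have B_meas [measurable]: "B k \<in> sets M" for k
    unfolding B_def by measurable
  have cover: "(\<Union>k<N. cball_n (c k) (t * r k)) \<subseteq> (\<Union>k<N. A k)"
  proof
    fix x assume "x \<in> (\<Union>k<N. cball_n (c k) (t * r k))"
    then obtain k where k: "k < N" "x \<in> space M" "nrm (\<lambda>l. x l - c k l) \<le> t * r k"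
      by (auto simp: cball_n_def)
    define v where "v = Min ((\<lambda>k. pw k x) ` {..<N})"
    have ne: "(\<lambda>k. pw k x) ` {..<N} \<noteq> {}" using k(1) by auto
    have v_le: "v \<le> pw i x" if "i < N" for i
      unfolding v_def using that by (intro Min_le) auto
    have "v \<in> (\<lambda>k. pw k x) ` {..<N}" unfolding v_def using ne by (intro Min_in) auto
    then have ex: "\<exists>i. i < N \<and> pw i x = v" by auto
    define q where "q = (LEAST i. i < N \<and> pw i x = v)"
    have q: "q < N" "pw q x = v" using LeastI_ex[OF ex] by (auto simp: q_def)
    have q_lt: "pw q x < pw i x" if "i < q" for i
    proof -
      have "i < N" "\<not> (i < N \<and> pw i x = v)"
        using that q(1) not_less_Least[of i "\<lambda>i. i < N \<and> pw i x = v"] by (simp_all add: q_def)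
      then show ?thesis using v_le[of i] q(2) by simp
    qed
    have "pw q x \<le> pw k x" using v_le[OF k(1)] q by simp
    also have "\<dots> \<le> 0" using k(3) by (simp add: pw_def power_mono)
    finally have "(nrm (\<lambda>l. x l - c q l))\<^sup>2 \<le> (t * r q)\<^sup>2" by (simp add: pw_def)
    then have "nrm (\<lambda>l. x l - c q l) \<le> t * r q"
      by (rule power2_le_imp_le) (use t r[OF q(1)] in auto)
    then have "x \<in> A q" using k(2) q v_le q_lt by (auto simp: A_def cball_n_def)
    then show "x \<in> (\<Union>k<N. A k)" using q by auto
  qed
  have AB: "emeasure M (A k) = ennreal (t ^ n) * emeasure M (B k)" for k
    unfolding B_def using emeasure_aff[of "A k" t "\<lambda>l. (1 - t) * c k l"] t by simp
  have B_sub: "B k \<subseteq> cball_n (c k) (r k)" for k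
  proof
    fix y assume y: "y \<in> B k"
    then have "(nrm (\<lambda>l. aff t (\<lambda>l. (1 - t) * c k l) y l - c k l)) \<le> t * r k"
      by (auto simp: B_def A_def cball_n_def)
    moreover have "nrm (\<lambda>l. aff t (\<lambda>l. (1 - t) * c k l) y l - c k l) = t * nrm (\<lambda>l. y l - c k l)"
    proof -
      have "nrm (\<lambda>l. aff t (\<lambda>l. (1 - t) * c k l) y l - c k l) = nrm (\<lambda>l. t * (y l - c k l))"
        by (intro nrm_cong) (simp add: algebra_simps)
      then show ?thesis using t by (simp add: nrm_scale)
    qed
    ultimately have "nrm (\<lambda>l. y l - c k l) \<le> r k" using t by simp
    then show "y \<in> cball_n (c k) (r k)" using y by (auto simp: B_def cball_n_def)
  qed
  have disj_lt: "B i \<inter> B k = {}" if ik: "i < k" "k < N" for i k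
  proof -
    have False if y: "y \<in> B i" "y \<in> B k" for y
    proof -
      let ?a = "(nrm (\<lambda>l. y l - c k l))\<^sup>2" and ?b = "(nrm (\<lambda>l. y l - c i l))\<^sup>2" and ?D = "(nrm (\<lambda>l. c k l - c i l))\<^sup>2"
      let ?x = "aff t (\<lambda>l. (1 - t) * c k l) y" and ?x' = "aff t (\<lambda>l. (1 - t) * c i l) y"
      have D': "(nrm (\<lambda>l. c i l - c k l))\<^sup>2 = ?D" by (subst nrm_minus) simp
      have z: "nrm (\<lambda>l. c m l - c m l) = 0" for m by (simp add: nrm_def)
      \<comment> \<open>The dilates of y about the two centres are different points, and each cell
        condition is read at its own dilate. After Stewart's identity the last terms cancel, and
        adding the two conditions leaves 0 < 2 (1 - t) \<open>?D\<close>, which is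
        impossible.\<close>
      have "pw k ?x < pw i ?x" using y(2) ik by (auto simp: B_def A_def)
      then have 1: "t * ?a - t * (1 - t) * ?a - (t * r k)\<^sup>2 < (1 - t) * ?D + t * ?b - t * (1 - t) * ?a - (t * r i)\<^sup>2"
        unfolding pw_def nrm_dilation_sq z by (simp only: power_zero_numeral mult_zero_right add_0)
      have "pw i ?x' \<le> pw k ?x'" using y(1) ik by (auto simp: B_def A_def)
      then have 2: "t * ?b - t * (1 - t) * ?b - (t * r i)\<^sup>2 \<le> (1 - t) * ?D + t * ?a - t * (1 - t) * ?b - (t * r k)\<^sup>2"
        unfolding pw_def nrm_dilation_sq z D' by (simp only: power_zero_numeral mult_zero_right add_0)
      have "(1 - t) * ?D \<le> 0" using t by (intro mult_nonpos_nonneg) auto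
      moreover have False if "p - u - R < w + q - u - Q" "q - v - Q \<le> w + p - v - R" "w \<le> 0" for p q u v w Q R :: real
        using that by linarith
      ultimately show False using 1 2 by blast
    qed
    then show ?thesis by auto
  qed
  have disj: "disjoint_family_on B {..<N}"
    unfolding disjoint_family_on_def using disj_lt by (metis inf_commute lessThan_iff linorder_neqE_nat)
  have "emeasure M (\<Union>k<N. cball_n (c k) (t * r k)) \<le> emeasure M (\<Union>k<N. A k)"
    by (intro emeasure_mono cover) auto
  also have "\<dots> \<le> (\<Sum>k<N. emeasure M (A k))"
    by (intro emeasure_subadditive_finite) auto
  also have "\<dots> = ennreal (t ^ n) * (\<Sum>k<N. emeasure M (B k))"
    by (simp add: AB sum_distrib_left)
  also have "(\<Sum>k<N. emeasure M (B k)) = emeasure M (\<Union>k<N. B k)"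
    by (intro sum_emeasure disj) auto
  also have "ennreal (t ^ n) * \<dots> \<le> ennreal (t ^ n) * emeasure M (\<Union>k<N. cball_n (c k) (r k))"
    using B_sub by (intro mult_left_mono emeasure_mono) auto
  finally show ?thesis .
qed

text \<open>An intermediate value argument: when the radius grows, the part outside U gains at most
  the volume of a shell, so its measure is continuous; it starts at 0 and reaches m.\<close>

lemma ex_radius_of_measure:
  assumes U [measurable]: "U \<in> sets M" and fin: "emeasure M U < \<infinity>" and m: "0 < m"
  shows "\<exists>r>0. emeasure M (cball_n c r - U) = ennreal m"
proof -
  define f where "f = (\<lambda>r. measure M (cball_n c r - U))"
  have ball_fin: "emeasure M (cball_n c r) < \<infinity>" if "0 \<le> r" for r
    using that by (simp add: emeasure_cball_n)
  have diff_fin: "emeasure M (cball_n c r - U) \<noteq> \<infinity>" if "0 \<le> r" for r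
  proof -
    have "emeasure M (cball_n c r - U) \<le> emeasure M (cball_n c r)" by (intro emeasure_mono) auto
    with ball_fin[OF that] show ?thesis by (auto simp: top_unique)
  qed
  have f_eq: "emeasure M (cball_n c r - U) = ennreal (f r)" if "0 \<le> r" for r
    unfolding f_def using diff_fin[OF that] by (intro emeasure_eq_ennreal_measure) auto
  have f_nonneg: "0 \<le> f r" for r by (simp add: f_def)
  have mono: "f s \<le> f r" "f r \<le> f s + ball_vol * (r ^ n - s ^ n)" if sr: "0 \<le> s" "s \<le> r" for s r
  proof -
    have r: "0 \<le> r" using sr by simp
    have sub: "cball_n c s \<subseteq> cball_n c r" using sr by (auto simp: cball_n_def)
    have "ennreal (f s) \<le> ennreal (f r)"
      unfolding f_eq[OF r, symmetric] f_eq[OF sr(1), symmetric] using sub by (intro emeasure_mono) auto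
    then show "f s \<le> f r" by (simp add: f_nonneg)
    have "ennreal (f r) \<le> emeasure M ((cball_n c s - U) \<union> (cball_n c r - cball_n c s))"
      unfolding f_eq[OF r, symmetric] by (intro emeasure_mono) auto
    also have "\<dots> \<le> emeasure M (cball_n c s - U) + emeasure M (cball_n c r - cball_n c s)"
      by (intro emeasure_subadditive) auto
    also have "emeasure M (cball_n c r - cball_n c s) = ennreal (ball_vol * r ^ n) - ennreal (ball_vol * s ^ n)"
      using sub ball_fin[OF sr(1)] sr r by (subst emeasure_Diff) (auto simp: emeasure_cball_n)
    also have "\<dots> = ennreal (ball_vol * r ^ n - ball_vol * s ^ n)"
      using sr by (intro ennreal_minus) (auto simp: less_imp_le)
    also have "emeasure M (cball_n c s - U) + \<dots> = ennreal (f s + ball_vol * (r ^ n - s ^ n))"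
      unfolding f_eq[OF sr(1)] right_diff_distrib[symmetric]
      using sr by (intro ennreal_plus[symmetric] f_nonneg mult_nonneg_nonneg) (auto simp: less_imp_le power_mono)
    finally show "f r \<le> f s + ball_vol * (r ^ n - s ^ n)"
      using sr by (subst (asm) ennreal_le_iff) (auto intro!: add_nonneg_nonneg f_nonneg mult_nonneg_nonneg simp: less_imp_le power_mono)
  qed
  have lip: "\<bar>f r - f s\<bar> \<le> \<bar>ball_vol * r ^ n - ball_vol * s ^ n\<bar>" if "0 \<le> r" "0 \<le> s" for r s
    using mono[of r s] mono[of s r] that by (cases "r \<le> s") (auto simp: algebra_simps)
  \<comment> \<open>Since R >= 1 gives R^n >= R, the ball of radius R has volume at least the
    measure of U plus m.\<close>
  define R where "R = max 1 ((measure M U + m) / ball_vol)"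
  have R: "1 \<le> R" by (simp add: R_def)
  have cont: "continuous_on {0..R} f"
  proof -
    have g: "continuous_on {0..R} (\<lambda>r. ball_vol * r ^ n)" by (intro continuous_intros)
    show ?thesis
      unfolding continuous_on_iff
    proof (intro ballI allI impI)
      fix x e :: real assume "x \<in> {0..R}" "0 < e"
      with g obtain d where d: "0 < d" "\<And>y. y \<in> {0..R} \<Longrightarrow> dist y x < d \<Longrightarrow> dist (ball_vol * y ^ n) (ball_vol * x ^ n) < e"
        unfolding continuous_on_iff by blast
      have "dist (f y) (f x) < e" if "y \<in> {0..R}" "dist y x < d" for y
        using d(2)[OF that] lip[of y x] that \<open>x \<in> {0..R}\<close> by (auto simp: dist_real_def)
      with d(1) show "\<exists>d>0. \<forall>y\<in>{0..R}. dist y x < d \<longrightarrow> dist (f y) (f x) < e" by blast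
    qed
  qed
  have f0: "f 0 \<le> 0"
  proof -
    have "ennreal (f 0) \<le> emeasure M (cball_n c 0)"
      unfolding f_eq[OF order_refl, symmetric] by (intro emeasure_mono) auto
    then show ?thesis by (simp add: emeasure_cball_n zero_power f_nonneg)
  qed
  have fR: "m \<le> f R"
  proof -
    have "ennreal (ball_vol * R ^ n) = emeasure M (cball_n c R)" using R by (simp add: emeasure_cball_n)
    also have "\<dots> \<le> emeasure M ((cball_n c R - U) \<union> U)" by (intro emeasure_mono) auto
    also have "\<dots> \<le> emeasure M (cball_n c R - U) + emeasure M U"
      by (intro emeasure_subadditive) auto
    also have "\<dots> = ennreal (f R + measure M U)"
    proof -
      have "emeasure M U = ennreal (measure M U)" using fin by (intro emeasure_eq_ennreal_measure) auto
      with f_eq[of R] R show ?thesis by (simp add: f_nonneg)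
    qed
    finally have "ball_vol * R ^ n \<le> f R + measure M U"
      by (subst (asm) ennreal_le_iff) (auto simp: f_nonneg)
    moreover have "ball_vol * ((measure M U + m) / ball_vol) \<le> ball_vol * R ^ n"
    proof (intro mult_left_mono)
      have "(measure M U + m) / ball_vol \<le> R" by (simp add: R_def)
      also have "R \<le> R ^ n" using R by (intro self_le_power) auto
      finally show "(measure M U + m) / ball_vol \<le> R ^ n" .
    qed (simp add: less_imp_le)
    ultimately show ?thesis using less_imp_neq[OF ball_vol_pos] by simp
  qed
  obtain r where r: "0 \<le> r" "r \<le> R" "f r = m"
    using IVT'[of f 0 m R] f0 fR m R cont by auto
  have "r \<noteq> 0" using r f0 m by auto
  with r f_eq[of r] show ?thesis by (intro exI[of _ r]) auto
qed

text \<open>Each set must lie in a ball about its own point mass for the kernel estimate, while the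
  union must be exactly a union of balls for the dilation estimate. Letting the next ball grow until
  its still uncovered part has the prescribed measure achieves both.\<close>

lemma ex_disjoint_exhaustion:
  fixes N :: nat
  assumes "\<forall>k<N. 0 < m k"
  shows "\<exists>r E. (\<forall>k<N. 0 < r k \<and> E k \<in> sets M \<and> E k \<subseteq> cball_n (c k) (r k) \<and> emeasure M (E k) = ennreal (m k)) \<and>
    disjoint_family_on E {..<N} \<and> (\<Union>k<N. E k) = (\<Union>k<N. cball_n (c k) (r k))"
  using assms
proof (induction N)
  case 0
  show ?case by (auto simp: disjoint_family_on_def)
next
  case (Suc N)
  then obtain r E where IH: "\<And>k. k < N \<Longrightarrow> 0 < r k \<and> E k \<in> sets M \<and> E k \<subseteq> cball_n (c k) (r k) \<and> emeasure M (E k) = ennreal (m k)"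
    "disjoint_family_on E {..<N}" "(\<Union>k<N. E k) = (\<Union>k<N. cball_n (c k) (r k))"
    by auto
  define U where "U = (\<Union>k<N. E k)"
  have U [measurable]: "U \<in> sets M" unfolding U_def using IH(1) by auto
  have "emeasure M U \<le> (\<Sum>k<N. emeasure M (E k))"
    unfolding U_def using IH(1) by (intro emeasure_subadditive_finite) auto
  also have "\<dots> < \<infinity>" using IH(1) by simp
  finally obtain s where s: "0 < s" "emeasure M (cball_n (c N) s - U) = ennreal (m N)"
    using ex_radius_of_measure[OF U, where m = "m N" and c = "c N"] Suc.prems by auto
  let ?r = "r(N := s)" and ?E = "E(N := cball_n (c N) s - U)"
  have "\<forall>k<Suc N. 0 < ?r k \<and> ?E k \<in> sets M \<and> ?E k \<subseteq> cball_n (c k) (?r k) \<and> emeasure M (?E k) = ennreal (m k)"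
    using IH(1) s by (auto simp: less_Suc_eq)
  moreover have "disjoint_family_on ?E {..<Suc N}"
    unfolding disjoint_family_on_def
  proof (intro ballI impI)
    fix i k assume ik: "i \<in> {..<Suc N}" "k \<in> {..<Suc N}" "i \<noteq> k"
    show "?E i \<inter> ?E k = {}"
    proof (cases "i < N \<and> k < N")
      case True
      then show ?thesis using disjoint_family_onD[OF IH(2), of i k] ik by simp
    next
      case False
      then show ?thesis using ik by (auto simp: U_def less_Suc_eq)
    qed
  qed
  moreover have "(\<Union>k<Suc N. ?E k) = (\<Union>k<Suc N. cball_n (c k) (?r k))"
  proof -
    have "(\<Union>k<Suc N. ?E k) = (cball_n (c N) s - U) \<union> (\<Union>k<N. E k)"
      by (auto simp: lessThan_Suc)
    also have "\<dots> = cball_n (c N) s \<union> (\<Union>k<N. cball_n (c k) (r k))"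
      unfolding IH(3)[symmetric] U_def by auto
    also have "\<dots> = (\<Union>k<Suc N. cball_n (c k) (?r k))"
      by (auto simp: lessThan_Suc)
    finally show ?thesis .
  qed
  ultimately show ?case by blast
qed

section \<open>The weak-type estimate\<close>

lemma riesz_kernel_cong: "(\<And>i. i < n \<Longrightarrow> x i = y i) \<Longrightarrow> j < n \<Longrightarrow> riesz_kernel e j x = riesz_kernel e j y"
  using reg_cong[of x y e] by (simp add: riesz_kernel_def)

lemma integrable_indicator_riesz_kernel:
  assumes e: "0 < e" and j: "j < n" and E [measurable]: "E \<in> sets M" and fin: "emeasure M E < \<infinity>"
  shows "integrable M (\<lambda>y. indicator E y * riesz_kernel e j (\<lambda>l. x l - y l))"
proof (rule Bochner_Integration.integrable_bound)
  show "integrable M (\<lambda>y. riesz_const / e ^ n * indicator E y)"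
    using fin by (intro integrable_mult_right integrable_real_indicator) auto
  show "AE y in M. norm (indicator E y * riesz_kernel e j (\<lambda>l. x l - y l)) \<le> norm (riesz_const / e ^ n * indicator E y)"
    using abs_riesz_kernel_bound[OF e j] e by (intro AE_I2) (auto simp: indicator_def less_imp_le)
qed (use j in measurable)

lemma measurable_riesz_set [measurable]:
  assumes j: "j < n" and [measurable]: "E \<in> sets M"
  shows "riesz_set e j E \<in> borel_measurable M"
  unfolding riesz_set_def using j by measurable

text \<open>A point mass m minus the indicator of E has total mass zero, so its transform is an
  integral over y in E of kernel differences; Tonelli and translation by c reduce the bound to
  \<open>riesz_kernel_far\<close>.\<close>

lemma nn_integral_far_part:
  assumes e: "0 < e" and j: "j < n" and r: "0 < r" and E [measurable]: "E \<in> sets M"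
    and sub: "E \<subseteq> cball_n c r" and m: "emeasure M E = ennreal m" "0 < m"
  shows "(\<integral>\<^sup>+x. ennreal (\<bar>m * riesz_kernel e j (\<lambda>l. x l - c l) - riesz_set e j E x\<bar> *
      indicator {(1 + 1 / n) * r<..} (nrm (\<lambda>l. x l - c l))) \<partial>M) \<le> ennreal (15 * ln n) * ennreal m"
proof -
  let ?K = "\<lambda>x y. riesz_kernel e j (\<lambda>l. x l - y l)"
  let ?i = "\<lambda>x. indicator {(1 + 1 / n) * r<..} (nrm (\<lambda>l. x l - c l)) :: real"
  have fin: "emeasure M E < \<infinity>" using m by simp
  have i_eq: "?i x = (if (1 + 1 / n) * r < nrm (\<lambda>l. x l - c l) then 1 else 0)" for x by auto
  have "(\<integral>\<^sup>+x. ennreal (\<bar>m * ?K x c - riesz_set e j E x\<bar> * ?i x) \<partial>M) \<le>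
      (\<integral>\<^sup>+x. \<integral>\<^sup>+y. indicator E y * ennreal (\<bar>?K x y - ?K x c\<bar> * ?i x) \<partial>M \<partial>M)"
  proof (rule nn_integral_mono)
    fix x
    have int: "integrable M (\<lambda>y. indicator E y * ?K x y)" "integrable M (\<lambda>y. indicator E y * ?K x c)"
      using integrable_indicator_riesz_kernel[OF e j E fin] fin
      by (auto intro!: integrable_mult_left integrable_real_indicator)
    have "measure M E = m" using m by (simp add: measure_def)
    then have "m * ?K x c - riesz_set e j E x = (\<integral>y. indicator E y * ?K x c - indicator E y * ?K x y \<partial>M)"
      unfolding riesz_set_def using int fin by (simp add: Bochner_Integration.integral_diff)
    then have "\<bar>m * ?K x c - riesz_set e j E x\<bar> \<le> (\<integral>y. \<bar>indicator E y * ?K x c - indicator E y * ?K x y\<bar> \<partial>M)"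
      by (simp add: integral_abs_bound)
    then have "\<bar>m * ?K x c - riesz_set e j E x\<bar> * ?i x \<le> (\<integral>y. \<bar>indicator E y * ?K x c - indicator E y * ?K x y\<bar> * ?i x \<partial>M)"
      by (auto simp: indicator_def)
    then have "ennreal (\<bar>m * ?K x c - riesz_set e j E x\<bar> * ?i x) \<le>
        ennreal (\<integral>y. \<bar>indicator E y * ?K x c - indicator E y * ?K x y\<bar> * ?i x \<partial>M)"
      by (rule ennreal_leI)
    also have "\<dots> = (\<integral>\<^sup>+y. ennreal (\<bar>indicator E y * ?K x c - indicator E y * ?K x y\<bar> * ?i x) \<partial>M)"
      using int by (intro nn_integral_eq_integral[symmetric] integrable_mult_left integrable_abs Bochner_Integration.integrable_diff) auto
    also have "\<dots> = (\<integral>\<^sup>+y. indicator E y * ennreal (\<bar>?K x y - ?K x c\<bar> * ?i x) \<partial>M)"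
      by (intro nn_integral_cong) (auto simp: indicator_def abs_minus_commute)
    finally show "ennreal (\<bar>m * ?K x c - riesz_set e j E x\<bar> * ?i x) \<le>
        (\<integral>\<^sup>+y. indicator E y * ennreal (\<bar>?K x y - ?K x c\<bar> * ?i x) \<partial>M)" .
  qed
  also have "\<dots> = (\<integral>\<^sup>+y. \<integral>\<^sup>+x. indicator E y * ennreal (\<bar>?K x y - ?K x c\<bar> * ?i x) \<partial>M \<partial>M)"
    unfolding i_eq using j by (intro MM.Fubini'[symmetric]) measurable
  also have "\<dots> \<le> (\<integral>\<^sup>+y. ennreal (15 * ln n) * indicator E y \<partial>M)"
  proof (rule nn_integral_mono)
    fix y
    show "(\<integral>\<^sup>+x. indicator E y * ennreal (\<bar>?K x y - ?K x c\<bar> * ?i x) \<partial>M) \<le> ennreal (15 * ln n) * indicator E y"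
    proof (cases "y \<in> E")
      case True
      let ?y = "\<lambda>l. y l - c l"
      have y: "nrm ?y \<le> r" using True sub by (auto simp: cball_n_def)
      let ?f = "\<lambda>x. ennreal (\<bar>riesz_kernel e j (\<lambda>l. x l - ?y l) - riesz_kernel e j x\<bar> * indicator {(1 + 1 / n) * r<..} (nrm x))"
      have "(\<integral>\<^sup>+x. ennreal (\<bar>?K x y - ?K x c\<bar> * ?i x) \<partial>M) = (\<integral>\<^sup>+x. ?f (\<lambda>l. x l - c l) \<partial>M)"
        by (intro nn_integral_cong) (simp add: algebra_simps)
      also have "\<dots> = (\<integral>\<^sup>+x. ?f x \<partial>M)"
      proof (rule nn_integral_shift_sub[of ?f])
        show "?f \<in> borel_measurable M" using j by measurable
        fix u v :: "nat \<Rightarrow> real" assume uv: "\<And>i. i < n \<Longrightarrow> u i = v i"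
        have "riesz_kernel e j u = riesz_kernel e j v" "riesz_kernel e j (\<lambda>l. u l - ?y l) = riesz_kernel e j (\<lambda>l. v l - ?y l)"
            "nrm u = nrm v"
          using uv j by (auto intro!: riesz_kernel_cong nrm_cong)
        then show "?f u = ?f v" by (simp only:)
      qed
      also have "\<dots> \<le> ennreal (15 * ln n)"
        by (rule riesz_kernel_far[OF e r y j])
      finally show ?thesis using True by simp
    qed simp
  qed
  also have "\<dots> = ennreal (15 * ln n) * ennreal m"
    by (simp add: nn_integral_cmult_indicator m)
  finally show ?thesis .
qed

lemma nn_integral_Markov_real:
  assumes [measurable]: "u \<in> borel_measurable M" and c: "0 < c"
  shows "emeasure M {x \<in> space M. c \<le> u x} \<le> ennreal (1 / c) * (\<integral>\<^sup>+x. ennreal (u x) \<partial>M)"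
proof -
  have eq: "{x \<in> space M. c \<le> u x} = {x \<in> space M. 1 \<le> ennreal (1 / c) * ennreal (u x)} "
  proof (intro Collect_cong conj_cong refl)
    fix x
    have "ennreal (1 / c * u x) = ennreal (1 / c) * ennreal (u x)"
      using c by (intro ennreal_mult') simp
    then have "1 \<le> ennreal (1 / c) * ennreal (u x) \<longleftrightarrow> ennreal 1 \<le> ennreal (1 / c * u x)"
      by (simp only: ennreal_1)
    also have "\<dots> \<longleftrightarrow> 1 \<le> 1 / c * u x" by (subst ennreal_le_iff2) auto
    also have "\<dots> \<longleftrightarrow> c \<le> u x" using c by (simp add: field_simps)
    finally show "c \<le> u x \<longleftrightarrow> 1 \<le> ennreal (1 / c) * ennreal (u x)" by simp
  qed
  show ?thesis
    unfolding eq using nn_integral_Markov_inequality[of "\<lambda>x. ennreal (u x)" "space M" M "ennreal (1 / c)"]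
    by (simp add: nn_set_integral_space)
qed

text \<open>After division by the level the threshold is 1. Outside the dilated balls the sum is
  bounded by the far parts plus the transform of the indicator of \<open>U\<close>; these are
  controlled in different norms, so Markov's inequality is applied to each separately.\<close>

lemma regularized_weak_type:
  fixes a :: "nat \<Rightarrow> real" and c :: "nat \<Rightarrow> nat \<Rightarrow> real" and N :: nat
  assumes e: "0 < e" and j: "j < n" and a: "\<forall>k<N. 0 < a k" and l: "0 < lev"
  shows "emeasure M {x \<in> space M. lev < \<bar>\<Sum>k<N. a k * riesz_kernel e j (\<lambda>i. x i - c k i)\<bar>} \<le>
    ennreal (131 * ln n * ((\<Sum>k<N. a k) / lev))"
proof -
  define m where "m = (\<lambda>k. a k / lev)"
  have m: "\<forall>k<N. 0 < m k" using a l by (simp add: m_def)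
  obtain r E where rE: "\<forall>k<N. 0 < r k \<and> E k \<in> sets M \<and> E k \<subseteq> cball_n (c k) (r k) \<and> emeasure M (E k) = ennreal (m k)"
      "disjoint_family_on E {..<N}" "(\<Union>k<N. E k) = (\<Union>k<N. cball_n (c k) (r k))"
    using ex_disjoint_exhaustion[OF m, of c] by blast
  have E: "\<And>k. k < N \<Longrightarrow> 0 < r k" "\<And>k. k < N \<Longrightarrow> E k \<in> sets M" "\<And>k. k < N \<Longrightarrow> E k \<subseteq> cball_n (c k) (r k)"
      "\<And>k. k < N \<Longrightarrow> emeasure M (E k) = ennreal (m k)" "disjoint_family_on E {..<N}"
      "(\<Union>k<N. E k) = (\<Union>k<N. cball_n (c k) (r k))"
    using rE by simp_all
  define U where "U = (\<Union>k<N. E k)"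
  have U [measurable]: "U \<in> sets M" unfolding U_def using E(2) by auto
  define A where "A = (\<Sum>k<N. m k)"
  have A: "0 \<le> A" unfolding A_def using m by (intro sum_nonneg) (auto simp: less_imp_le)
  have m_sum: "(\<Sum>k<N. ennreal (m k)) = ennreal A"
    unfolding A_def using m by (intro sum_ennreal) (auto simp: less_imp_le)
  have U_vol: "emeasure M U = ennreal A"
  proof -
    have "emeasure M U = (\<Sum>k<N. emeasure M (E k))"
      unfolding U_def using E(2,5) by (intro sum_emeasure[symmetric]) auto
    also have "\<dots> = ennreal A"
      using E(4) by (simp flip: m_sum)
    finally show ?thesis .
  qed
  define t where "t = 1 + 1 / real n"
  define S where "S = (\<Union>k<N. cball_n (c k) (t * r k))"
  have S [measurable]: "S \<in> sets M" unfolding S_def by auto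
  have S_vol: "emeasure M S \<le> ennreal (3 * A)"
  proof -
    have "t ^ n \<le> exp 1"
      using exp_ge_one_plus_x_over_n_power_n[where x = 1 and n = n] by (simp add: t_def)
    then have "t ^ n \<le> 3" using exp_le by linarith
    have "emeasure M S \<le> ennreal (t ^ n) * emeasure M U"
      unfolding S_def U_def E(6) using E(1) by (intro emeasure_dilated_balls_le) (auto simp: t_def less_imp_le)
    also have "\<dots> \<le> ennreal 3 * ennreal A"
      unfolding U_vol using \<open>t ^ n \<le> 3\<close> by (intro mult_right_mono ennreal_leI) auto
    finally show ?thesis using A by (simp add: ennreal_mult)
  qed
  let ?K = "\<lambda>k x. riesz_kernel e j (\<lambda>i. x i - c k i)"
  define D where "D = (\<lambda>k x. \<bar>m k * ?K k x - riesz_set e j (E k) x\<bar> * indicator {t * r k<..} (nrm (\<lambda>l. x l - c k l)))"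
  have ind_eq: "indicator {t * r k<..} (nrm z) = (if t * r k < nrm z then 1 else 0 :: real)" for k z by auto
  have D_meas [measurable]: "D k \<in> borel_measurable M" if "k < N" for k
    unfolding D_def ind_eq using j E(2)[OF that] by measurable
  have D_nonneg: "0 \<le> D k x" for k x by (simp add: D_def)
  have D_int: "(\<integral>\<^sup>+x. ennreal (\<Sum>k<N. D k x) \<partial>M) \<le> ennreal (15 * ln n * A)"
  proof -
    have "(\<integral>\<^sup>+x. ennreal (\<Sum>k<N. D k x) \<partial>M) = (\<Sum>k<N. \<integral>\<^sup>+x. ennreal (D k x) \<partial>M)"
      by (subst nn_integral_sum[symmetric]) (auto simp: sum_ennreal D_nonneg)
    also have "\<dots> \<le> (\<Sum>k<N. ennreal (15 * ln n) * ennreal (m k))"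
      unfolding D_def t_def using E m by (intro sum_mono nn_integral_far_part e j) auto
    also have "\<dots> = ennreal (15 * ln n) * ennreal A"
      by (simp only: sum_distrib_left[symmetric] m_sum)
    finally show ?thesis using A n2 by (simp add: ennreal_mult)
  qed
  \<comment> \<open>Disjointness enters here: for overlapping sets the sum of the indicators would
    no longer be an indicator, and \<open>riesz_L2\<close> would not apply.\<close>
  have T_sum: "riesz_set e j U x = (\<Sum>k<N. riesz_set e j (E k) x)" for x
  proof -
    have ind: "indicator U y = (\<Sum>k<N. indicator (E k) y :: real)" for y
      unfolding U_def using E(5) by (simp add: indicator_UN_disjoint)
    show ?thesis
      unfolding riesz_set_def ind sum_distrib_right
      using E(2,4) by (intro Bochner_Integration.integral_sum integrable_indicator_riesz_kernel e j) auto
  qed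
  \<comment> \<open>The threshold 1 is halved: the far parts get 1/2, and the square of the other
    term is compared with (1/2)^2.\<close>
  let ?B1 = "{x \<in> space M. 1 / 2 \<le> (\<Sum>k<N. D k x)}" and ?B2 = "{x \<in> space M. 1 / 4 \<le> (riesz_set e j U x)\<^sup>2}"
  have sets_B: "?B1 \<in> sets M" "?B2 \<in> sets M"
    using j by measurable
  have sub: "{x \<in> space M. lev < \<bar>\<Sum>k<N. a k * ?K k x\<bar>} \<subseteq> S \<union> (?B1 \<union> ?B2)"
  proof
    fix x assume "x \<in> {x \<in> space M. lev < \<bar>\<Sum>k<N. a k * ?K k x\<bar>}"
    then have x: "x \<in> space M" "lev < \<bar>\<Sum>k<N. a k * ?K k x\<bar>" by auto
    show "x \<in> S \<union> (?B1 \<union> ?B2)"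
    proof (rule ccontr)
      assume not: "x \<notin> S \<union> (?B1 \<union> ?B2)"
      have far: "t * r k < nrm (\<lambda>l. x l - c k l)" if "k < N" for k
        using not that x(1) by (force simp: S_def cball_n_def)
      have "(\<Sum>k<N. a k * ?K k x) = lev * (\<Sum>k<N. m k * ?K k x)"
        using l by (simp add: m_def sum_distrib_left)
      with x(2) l have 1: "1 < \<bar>\<Sum>k<N. m k * ?K k x\<bar>" by (simp add: abs_mult)
      have "(\<Sum>k<N. m k * ?K k x) = (\<Sum>k<N. m k * ?K k x - riesz_set e j (E k) x) + riesz_set e j U x"
        by (simp add: T_sum sum_subtractf)
      then have "\<bar>\<Sum>k<N. m k * ?K k x\<bar> \<le> \<bar>\<Sum>k<N. m k * ?K k x - riesz_set e j (E k) x\<bar> + \<bar>riesz_set e j U x\<bar>"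
        by simp
      also have "\<bar>\<Sum>k<N. m k * ?K k x - riesz_set e j (E k) x\<bar> \<le> (\<Sum>k<N. \<bar>m k * ?K k x - riesz_set e j (E k) x\<bar>)"
        by (rule sum_abs)
      also have "\<dots> = (\<Sum>k<N. D k x)"
        using far by (simp add: D_def)
      finally have 2: "1 < (\<Sum>k<N. D k x) + \<bar>riesz_set e j U x\<bar>" using 1 by linarith
      have "(\<Sum>k<N. D k x) < 1 / 2" using not x(1) by auto
      with 2 have "1 / 2 < \<bar>riesz_set e j U x\<bar>" by linarith
      then have "(1 / 2)\<^sup>2 \<le> \<bar>riesz_set e j U x\<bar>\<^sup>2" by (intro power_mono) auto
      with not x(1) show False by (simp add: power2_eq_square)
    qed
  qed
  have "emeasure M {x \<in> space M. lev < \<bar>\<Sum>k<N. a k * ?K k x\<bar>} \<le> emeasure M (S \<union> (?B1 \<union> ?B2))"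
    using sub S sets_B by (intro emeasure_mono sets.Un)
  also have "\<dots> \<le> emeasure M S + (emeasure M ?B1 + emeasure M ?B2)"
    by (rule order_trans[OF emeasure_subadditive add_left_mono[OF emeasure_subadditive]]) (use S sets_B in auto)
  also have "\<dots> \<le> ennreal (3 * A) + (ennreal (30 * ln n * A) + ennreal (64 * A))"
  proof (intro add_mono S_vol)
    have "emeasure M ?B1 \<le> ennreal (1 / (1 / 2)) * (\<integral>\<^sup>+x. ennreal (\<Sum>k<N. D k x) \<partial>M)"
      by (rule nn_integral_Markov_real) auto
    also have "\<dots> \<le> ennreal (1 / (1 / 2)) * ennreal (15 * ln n * A)"
      by (intro mult_left_mono D_int) auto
    also have "\<dots> = ennreal (30 * ln n * A)"
      using A n2 by (subst ennreal_mult[symmetric]) auto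
    finally show "emeasure M ?B1 \<le> ennreal (30 * ln n * A)" .
    have "emeasure M ?B2 \<le> ennreal (1 / (1 / 4)) * (\<integral>\<^sup>+x. ennreal ((riesz_set e j U x)\<^sup>2) \<partial>M)"
      by (rule nn_integral_Markov_real) (use j in auto)
    also have "\<dots> \<le> ennreal (1 / (1 / 4)) * (ennreal (pi\<^sup>2) * emeasure M U)"
      using U_vol by (intro mult_left_mono riesz_L2 e j U) auto
    also have "\<dots> = ennreal (4 * pi\<^sup>2 * A)"
      unfolding U_vol using A by (simp add: ennreal_mult mult.assoc)
    also have "\<dots> \<le> ennreal (64 * A)"
    proof -
      have "pi\<^sup>2 \<le> 4\<^sup>2" using pi_less_4 by (intro power_mono) auto
      then show ?thesis using A by (intro ennreal_leI mult_right_mono) auto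
    qed
    finally show "emeasure M ?B2 \<le> ennreal (64 * A)" .
  qed
  also have "\<dots> = ennreal (3 * A + (30 * ln n * A + 64 * A))"
  proof -
    have "0 \<le> 30 * ln n * A" "0 \<le> 64 * A" "0 \<le> 3 * A" using A n2 by simp_all
    then show ?thesis by (simp only: ennreal_plus add_nonneg_nonneg)
  qed
  also have "\<dots> \<le> ennreal (131 * ln n * A)"
  proof (rule ennreal_leI)
    \<comment> \<open>The 131 is made up of 30 = 2 * 15 from the far parts and 101, which absorbs 67
      = 3 + 64 because 101 * 2/3 > 67; here 64 comes from 4 pi^2 with pi < 4.\<close>
    have "2 / 3 \<le> ln (2::real)" using ln2_ge_two_thirds .
    also have "\<dots> \<le> ln n" using n2 by simp
    finally have "67 * A \<le> (101 * ln n) * A" using A by (intro mult_right_mono) auto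
    then show "3 * A + (30 * ln n * A + 64 * A) \<le> 131 * ln n * A" by (simp add: algebra_simps)
  qed
  also have "A = (\<Sum>k<N. a k) / lev" by (simp add: A_def m_def sum_divide_distrib)
  finally show ?thesis .
qed

text \<open>The regularized estimate is uniform in e. Away from the point masses the regularized
  sums converge, so a strict inequality for the limit holds from some index on. The sets
  \<open>G\<close> on which it holds from index m on increase with m, and continuity from below
  transfers the bound.\<close>

lemma riesz_discrete_weak_type:
  assumes j: "j < n" and a: "\<forall>k<N. 0 < a k" and c: "\<forall>k<N. c k \<in> space M" and l: "0 < lev"
  shows "emeasure M {x \<in> space M. (\<forall>k<N. x \<noteq> c k) \<and> lev < \<bar>riesz_discrete n j N a c x\<bar>} \<le>
    ennreal (131 * ln n * ((\<Sum>k<N. a k) / lev))"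
proof -
  define R where "R = (\<lambda>e x. \<Sum>k<N. a k * riesz_kernel e j (\<lambda>i. x i - c k i))"
  define e where "e = (\<lambda>i. 1 / real (Suc i))"
  have e: "0 < e i" for i by (simp add: e_def)
  have e_lim: "e \<longlonglongrightarrow> 0" unfolding e_def using LIMSEQ_inverse_real_of_nat by (simp add: inverse_eq_divide)
  have R_meas [measurable]: "R e \<in> borel_measurable M" for e
    unfolding R_def using j by measurable
  define G where "G = (\<lambda>m. {x \<in> space M. \<forall>i\<ge>m. lev < \<bar>R (e i) x\<bar>})"
  have G_sets [measurable]: "G m \<in> sets M" for m
    unfolding G_def by measurable
  have G_le: "emeasure M (G m) \<le> ennreal (131 * ln n * ((\<Sum>k<N. a k) / lev))" for m
  proof -
    have "emeasure M (G m) \<le> emeasure M {x \<in> space M. lev < \<bar>R (e m) x\<bar>}"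
      by (intro emeasure_mono) (auto simp: G_def)
    also have "\<dots> \<le> ennreal (131 * ln n * ((\<Sum>k<N. a k) / lev))"
      unfolding R_def by (rule regularized_weak_type[OF e j a l])
    finally show ?thesis .
  qed
  have sub: "{x \<in> space M. (\<forall>k<N. x \<noteq> c k) \<and> lev < \<bar>riesz_discrete n j N a c x\<bar>} \<subseteq> (\<Union>m. G m)"
  proof
    fix x assume "x \<in> {x \<in> space M. (\<forall>k<N. x \<noteq> c k) \<and> lev < \<bar>riesz_discrete n j N a c x\<bar>}"
    then have x: "x \<in> space M" "\<And>k. k < N \<Longrightarrow> x \<noteq> c k" "lev < \<bar>riesz_discrete n j N a c x\<bar>" by auto
    have "(\<lambda>i. riesz_kernel (e i) j (\<lambda>i. x i - c k i)) \<longlonglongrightarrow> riesz_const * (x j - c k j) / nrm (\<lambda>i. x i - c k i) ^ (n + 1)"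
      if k: "k < N" for k
    proof -
      have "nrm (\<lambda>i. x i - c k i) \<noteq> 0"
      proof
        assume "nrm (\<lambda>i. x i - c k i) = 0"
        then have "\<forall>i<n. x i = c k i"
          using abs_coord_le_nrm[of _ "\<lambda>i. x i - c k i"] by force
        \<comment> \<open>Both functions are points of the product space, so agreement on the first
          n coordinates is equality.\<close>
        then have "x = c k" using x(1) c k by (intro PiE_ext[of _ "{..<n}" "\<lambda>_. UNIV"]) (auto simp: space_PiM)
        with x(2)[OF k] show False by simp
      qed
      moreover have "(\<lambda>i. reg (e i) (\<lambda>i. x i - c k i)) \<longlonglongrightarrow> sqrt ((nrm (\<lambda>i. x i - c k i))\<^sup>2 + 0\<^sup>2)"
        unfolding reg_def by (intro tendsto_intros e_lim)
      then have "(\<lambda>i. reg (e i) (\<lambda>i. x i - c k i)) \<longlonglongrightarrow> nrm (\<lambda>i. x i - c k i)" by simp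
      ultimately show ?thesis
        unfolding riesz_kernel_def by (intro tendsto_intros) auto
    qed
    then have "(\<lambda>i. R (e i) x) \<longlonglongrightarrow> (\<Sum>k<N. a k * (riesz_const * (x j - c k j) / nrm (\<lambda>i. x i - c k i) ^ (n + 1)))"
      unfolding R_def by (intro tendsto_sum tendsto_mult tendsto_const) auto
    also have "(\<Sum>k<N. a k * (riesz_const * (x j - c k j) / nrm (\<lambda>i. x i - c k i) ^ (n + 1))) = riesz_discrete n j N a c x"
      unfolding riesz_discrete_def riesz_const_def dist_n_def nrm_def sum_distrib_left
      by (intro sum.cong) (auto simp: mult_ac)
    finally have "(\<lambda>i. \<bar>R (e i) x\<bar>) \<longlonglongrightarrow> \<bar>riesz_discrete n j N a c x\<bar>"
      by (rule tendsto_rabs)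
    from order_tendstoD(1)[OF this x(3)] obtain m where "\<forall>i\<ge>m. lev < \<bar>R (e i) x\<bar>"
      by (auto simp: eventually_sequentially)
    with x(1) show "x \<in> (\<Union>m. G m)" by (auto simp: G_def)
  qed
  have "emeasure M {x \<in> space M. (\<forall>k<N. x \<noteq> c k) \<and> lev < \<bar>riesz_discrete n j N a c x\<bar>} \<le> emeasure M (\<Union>m. G m)"
    using sub by (intro emeasure_mono) auto
  also have "\<dots> = (SUP m. emeasure M (G m))"
    by (intro SUP_emeasure_incseq[symmetric]) (auto simp: incseq_def G_def)
  also have "\<dots> \<le> ennreal (131 * ln n * ((\<Sum>k<N. a k) / lev))"
    by (intro SUP_least G_le)
  finally show ?thesis .
qed

end

theorem theorem1p2:
  shows "\<exists>C::real. C > 0 \<and>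
    (\<forall>n::nat. \<forall>j::nat. \<forall>N::nat. \<forall>a::nat \<Rightarrow> real. \<forall>c::nat \<Rightarrow> nat \<Rightarrow> real.
       n \<ge> 2 \<longrightarrow> j < n \<longrightarrow> (\<forall>k<N. a k > 0) \<longrightarrow>
       (\<forall>k<N. c k \<in> space (lebesgue_n n)) \<longrightarrow>
       (SUP l\<in>{0::real<..}. ennreal l * emeasure (lebesgue_n n)
           {x \<in> space (lebesgue_n n). (\<forall>k<N. x \<noteq> c k) \<and>
                \<bar>riesz_discrete n j N a c x\<bar> > l})
       \<le> ennreal (C * ln (real n) * (\<Sum>k<N. a k)))"
proof (intro exI[of _ 131] conjI allI impI SUP_least)
  fix n j N :: nat and a :: "nat \<Rightarrow> real" and c :: "nat \<Rightarrow> nat \<Rightarrow> real" and l :: real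
  assume n: "2 \<le> n" and j: "j < n" and a: "\<forall>k<N. a k > 0"
    and c: "\<forall>k<N. c k \<in> space (lebesgue_n n)" and l: "l \<in> {0<..}"
  interpret euclid_dim n by standard (rule n)
  have "ennreal l * emeasure (lebesgue_n n) {x \<in> space (lebesgue_n n). (\<forall>k<N. x \<noteq> c k) \<and> \<bar>riesz_discrete n j N a c x\<bar> > l}
      \<le> ennreal l * ennreal (131 * ln n * ((\<Sum>k<N. a k) / l))"
    unfolding lebesgue_n_def
    using c l by (intro mult_left_mono riesz_discrete_weak_type j a) (auto simp: lebesgue_n_def)
  also have "\<dots> = ennreal (131 * ln n * (\<Sum>k<N. a k))"
  proof -
    have "0 \<le> (\<Sum>k<N. a k)" using a by (intro sum_nonneg) (auto simp: less_imp_le)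
    then show ?thesis using l n by (subst ennreal_mult[symmetric]) auto
  qed
  finally show "ennreal l * emeasure (lebesgue_n n) {x \<in> space (lebesgue_n n). (\<forall>k<N. x \<noteq> c k) \<and> \<bar>riesz_discrete n j N a c x\<bar> > l}
      \<le> ennreal (131 * ln n * (\<Sum>k<N. a k))" .
qed simp

end
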